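(* Let $\Phi=\{f_i(x)=r_iO_ix+t_i\}_{i=1}^n$ be a self-similar IFS on $\mathbb R^d$, $d\ge3$ (with $0<|r_i|<1$, $O_i\in\mathrm{SO}(d)$, $t_i\in\mathbb R^d$), let $\mathbf p$ be a strictly positive probability vector, and let $\nu=\nu_{\mathbf p}$ be the corresponding self-similar measure. Let $\mathcal A:=\{|r_i|:1\le i\le n\}$ and, for $a\in\mathcal A$, $I_a:=\{i:|r_i|=a\}$, $\widetilde p_a:=\sum_{i\in I_a}p_i$, and let $P_a^G$ be the Markov operator on $L^2(\mathrm{SO}(d))$ defined by $P_a^GF(g)=\sum_{i\in I_a}\frac{p_i}{\widetilde p_a}F(O_i^{-1}g)$. Fix $\sigma>\frac{d-1}{2}$ and set $$\Lambda:=-\log\Big(\sum_{a\in\mathcal A}\widetilde p_a\|P_a^G\|_{L^2_0(\mathrm{SO}(d))}\Big),\qquad \Gamma:=\frac{\Lambda}{\max_i(-\log|r_i|)}.$$ Assume that $\Gamma>0$ and that for some $\beta>0$, $$\int_{S^{d-1}}|\mathcal F_{R\omega}(\nu)|^2\,d\sigma_{S^{d-1}}(\omega)\lesssim R^{-\beta}.$$ Then $$\dim_F\nu\ge\min\Big\{d,\ \frac{\beta\Gamma}{\beta+\sigma+\Gamma}\Big\}.$$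
   Context: $\nu_{\mathbf p}$ is the unique Borel probability measure with $\nu=\sum_ip_if_i\nu$ (push-forwards). $L^2_0(\mathrm{SO}(d))$ is the zero-mean subspace of $L^2(\mathrm{SO}(d))$ (normalized Haar measure), and $\|\cdot\|_{L^2_0(\mathrm{SO}(d))}$ denotes operator norm of the restriction to it. $\sigma_{S^{d-1}}$ is the normalized surface measure on $S^{d-1}$ (distinct from the number $\sigma$). $\mathcal F_\xi(\nu)=\int e^{-2\pi i\langle x,\xi\rangle}d\nu(x)$. The notation $A(R)\lesssim R^{-\beta}$ means $A(R)\le CR^{-\beta}$ for all $R>0$ with $C$ independent of $R$. $\dim_F\nu=\sup\{0\le s\le d:|\mathcal F_\xi(\nu)|\lesssim|\xi|^{-s/2}\}$. *)

theory Defs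
  imports "HOL-Probability.Probability"
begin

definition SO :: "(real^'d^'d) set" where
  "SO = {Q. rotation_matrix Q}"

(* Normalized Haar measure, characterized as the left-invariant Borel probability
   measure on the compact group SO(d); it exists and is unique. *)
definition is_haar_SO :: "(real^'d^'d) measure \<Rightarrow> bool" where
  "is_haar_SO \<mu> \<longleftrightarrow>
     sets \<mu> = sets (restrict_space borel SO) \<and> prob_space \<mu> \<and>
     (\<forall>Q\<in>SO. distr \<mu> \<mu> (\<lambda>g. Q ** g) = \<mu>)"

definition L2_norm :: "'a measure \<Rightarrow> ('a \<Rightarrow> complex) \<Rightarrow> real" where
  "L2_norm \<mu> F = sqrt (LINT x|\<mu>. (cmod (F x))\<^sup>2)"

(* Elements of L^2 are represented by functions rather than by classes modulo null sets;
   L2_norm and the operator norm below do not depend on the representative. *)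
definition L2_zero_mean :: "'a measure \<Rightarrow> ('a \<Rightarrow> complex) set" where
  "L2_zero_mean \<mu> = {F. F \<in> borel_measurable \<mu> \<and>
     integrable \<mu> (\<lambda>x. (cmod (F x))\<^sup>2) \<and> (LINT x|\<mu>. F x) = 0}"

definition op_norm_zero_mean ::
    "'a measure \<Rightarrow> (('a \<Rightarrow> complex) \<Rightarrow> ('a \<Rightarrow> complex)) \<Rightarrow> real" where
  "op_norm_zero_mean \<mu> T =
     Sup {L2_norm \<mu> (T F) | F. F \<in> L2_zero_mean \<mu> \<and> L2_norm \<mu> F \<le> 1}"

definition self_similar_measure ::
    "nat \<Rightarrow> (nat \<Rightarrow> real) \<Rightarrow> (nat \<Rightarrow> real^'d \<Rightarrow> real^'d) \<Rightarrow> (real^'d) measure \<Rightarrow> bool" where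
  "self_similar_measure n p f \<nu> \<longleftrightarrow>
     sets \<nu> = sets borel \<and> prob_space \<nu> \<and>
     (\<forall>A\<in>sets borel. measure \<nu> A = (\<Sum>i=1..n. p i * measure (distr \<nu> borel (f i)) A))"

definition fourier_measure :: "(real^'d) measure \<Rightarrow> real^'d \<Rightarrow> complex" where
  "fourier_measure \<nu> \<xi> = (LINT x|\<nu>. exp (- 2 * of_real pi * \<i> * of_real (x \<bullet> \<xi>)))"

definition fourier_dim :: "(real^'d) measure \<Rightarrow> real" where
  "fourier_dim \<nu> = Sup {s. 0 \<le> s \<and> s \<le> real CARD('d) \<and>
     (\<exists>C. \<forall>\<xi>. \<xi> \<noteq> 0 \<longrightarrow> cmod (fourier_measure \<nu> \<xi>) \<le> C * norm \<xi> powr (- s / 2))}"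

(* Normalized surface measure on the unit sphere, by polar coordinates: the measure of a set
   of directions is the proportion of the unit ball filled by the cone over that set
   (sgn x = x / norm x).  It is regarded as a measure on the ambient space. *)
definition sphere_measure :: "(real^'d) measure" where
  "sphere_measure = distr (uniform_measure lborel (ball 0 1)) borel sgn"

definition level_set :: "nat \<Rightarrow> (nat \<Rightarrow> real) \<Rightarrow> real \<Rightarrow> nat set" where
  "level_set n r a = {i\<in>{1..n}. \<bar>r i\<bar> = a}"

definition level_weight :: "nat \<Rightarrow> (nat \<Rightarrow> real) \<Rightarrow> (nat \<Rightarrow> real) \<Rightarrow> real \<Rightarrow> real" where
  "level_weight n r p a = (\<Sum>i\<in>level_set n r a. p i)"

definition markov_op ::
    "nat \<Rightarrow> (nat \<Rightarrow> real) \<Rightarrow> (nat \<Rightarrow> real) \<Rightarrow> (nat \<Rightarrow> real^'d^'d) \<Rightarrow> real \<Rightarrow>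
     (real^'d^'d \<Rightarrow> complex) \<Rightarrow> (real^'d^'d \<Rightarrow> complex)" where
  "markov_op n r p Q a F =
     (\<lambda>g. \<Sum>i\<in>level_set n r a. of_real (p i / level_weight n r p a) * F (matrix_inv (Q i) ** g))"

(* The argument of ln is positive for d >= 2: each norm is positive, since a convolution
   operator by a finitely supported measure cannot annihilate L^2_0 of an infinite compact
   group.  So the convention ln 0 = 0 plays no role. *)
definition Lambda ::
    "(real^'d^'d) measure \<Rightarrow> nat \<Rightarrow> (nat \<Rightarrow> real) \<Rightarrow> (nat \<Rightarrow> real) \<Rightarrow> (nat \<Rightarrow> real^'d^'d) \<Rightarrow> real" where
  "Lambda \<mu> n r p Q =
     - ln (\<Sum>a\<in>(\<lambda>i. \<bar>r i\<bar>) ` {1..n}.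
             level_weight n r p a * op_norm_zero_mean \<mu> (markov_op n r p Q a))"

definition Gamma_rate ::
    "(real^'d^'d) measure \<Rightarrow> nat \<Rightarrow> (nat \<Rightarrow> real) \<Rightarrow> (nat \<Rightarrow> real) \<Rightarrow> (nat \<Rightarrow> real^'d^'d) \<Rightarrow> real" where
  "Gamma_rate \<mu> n r p Q = Lambda \<mu> n r p Q / Max ((\<lambda>i. - ln \<bar>r i\<bar>) ` {1..n})"

end

theory Submission
  imports Defs
begin

text \<open>The function \<open>\<phi> \<xi> = (cmod (fourier_measure \<nu> \<xi>))\<^sup>2\<close> lies below an average of rotated copies of
  itself at the smaller frequencies \<open>\<bar>r i\<bar> \<xi>\<close> (\<open>phi_subaverage\<close>).  Iterating, with the maps grouped by
  their contraction ratio, bounds \<open>\<phi>\<close> at frequency \<open>R\<close> by a weighted sum, over words of ratios, of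
  iterated rotation averages of \<open>\<phi>\<close> near a lower frequency \<open>T\<close>.  On each orbit of the rotation group
  such an average is a product of Markov operators applied to \<open>g \<mapsto> \<phi> (g x)\<close>.  It therefore fixes the
  orbit mean, which is the spherical mean of size \<open>T powr (- \<beta>)\<close> in the hypothesis, and contracts the
  deviation from it in \<open>L\<^sup>2\<close> by the product of the operator norms (\<open>rot_avgs_deviation\<close>).

  The mean-square bound has to be turned into a pointwise one.  As \<open>\<nu>\<close> has bounded support, a high
  difference of its Fourier transform with a short step is negligible, so that the value of \<open>\<phi>\<close> at a
  point is controlled by its values at neighbouring points \<open>\<eta> + k v\<close> (\<open>fourier_difference\<close>).  This
  inequality survives rotation averages.  Averaging it over the step \<open>v\<close> bounds the value at \<open>\<eta>\<close> by an
  integral over a thin annulus, and the integral over the annulus is computed by integrating over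
  orbits first (\<open>pointwise_from_orbit_means\<close>).  The loss is a factor \<open>T powr \<sigma>\<close> for any \<open>\<sigma>\<close> beyond
  \<open>(d - 1) / 2\<close> (\<open>scale_bound\<close>), as with Sobolev's inequality on the sphere.

  The descent from \<open>R\<close> to \<open>T\<close> takes at least about \<open>ln (R / T) / max (- ln \<bar>r i\<bar>)\<close> steps, and every step
  gains the factor \<open>exp (- \<Lambda>)\<close> on the deviation (\<open>descent\<close>).  Hence
  \<open>\<phi> = O (T powr (- \<beta>) + (R / T) powr (- \<Gamma>) * T powr \<sigma>)\<close>, and the choice
  \<open>T = R powr (\<Gamma> / (\<beta> + \<sigma> + \<Gamma>))\<close> makes both terms equal to \<open>R powr (- \<beta> \<Gamma> / (\<beta> + \<sigma> + \<Gamma>))\<close>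
  (\<open>phi_decay\<close>).\<close>

section \<open>Rotations and Lebesgue measure\<close>

lemma SO_orthogonal: "Q \<in> SO \<Longrightarrow> orthogonal_matrix Q"
  by (simp add: SO_def rotation_matrix_def)

lemma SO_transpose_mult:
  assumes "Q \<in> SO"
  shows "transpose Q ** Q = mat 1" "Q ** transpose Q = mat 1"
  using SO_orthogonal[OF assms] by (auto simp: orthogonal_matrix_def)

lemma SO_mult: "P \<in> SO \<Longrightarrow> Q \<in> SO \<Longrightarrow> P ** Q \<in> SO"
  by (simp add: SO_def rotation_matrix_def orthogonal_matrix_mul det_mul)

lemma SO_transpose: "Q \<in> SO \<Longrightarrow> transpose Q \<in> SO"
  by (simp add: SO_def rotation_matrix_def)

lemma SO_matrix_inv:
  assumes "Q \<in> SO"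
  shows "matrix_inv Q = transpose Q"
proof -
  have ex: "\<exists>A. Q ** A = mat 1 \<and> A ** Q = mat 1"
    using SO_transpose_mult[OF assms] by blast
  have "Q ** matrix_inv Q = mat 1 \<and> matrix_inv Q ** Q = mat 1"
    unfolding matrix_inv_def by (rule someI_ex[OF ex])
  then show ?thesis
    by (metis SO_transpose_mult(1) assms matrix_mul_assoc matrix_mul_lid matrix_mul_rid)
qed

lemma SO_matrix_inv_in: "Q \<in> SO \<Longrightarrow> matrix_inv Q \<in> SO"
  by (simp add: SO_matrix_inv SO_transpose)

lemma SO_norm: "Q \<in> SO \<Longrightarrow> norm (Q *v x) = norm x"
  using SO_orthogonal[of Q] orthogonal_transformation_matrix[of "(*v) Q"]
  by (simp add: orthogonal_transformation_def norm_eq)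

lemma SO_inner:
  assumes "Q \<in> SO"
  shows "(Q *v x) \<bullet> y = x \<bullet> (matrix_inv Q *v y)"
  by (simp add: SO_matrix_inv[OF assms] dot_lmul_matrix[symmetric] inner_commute)

lemma SO_transitive:
  fixes x y :: "real^'d"
  assumes "CARD('d) \<ge> 2" "norm x = norm y"
  obtains Q where "Q \<in> SO" "Q *v x = y"
proof -
  obtain h where h: "orthogonal_transformation h" "det (matrix h) = 1" "h x = y"
    using rotation_exists[OF assms] by auto
  then have "matrix h \<in> SO" "matrix h *v x = y"
    by (auto simp: SO_def rotation_matrix_def orthogonal_transformation_matrix
        orthogonal_transformation_linear)
  then show ?thesis by (rule that)
qed

lemma measurable_mult_vec_pair:
  "(\<lambda>z::(real^'d^'d) \<times> (real^'d). fst z *v snd z) \<in> borel \<Otimes>\<^sub>M borel \<rightarrow>\<^sub>M borel"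
proof -
  have "continuous_on UNIV (\<lambda>z::(real^'d^'d) \<times> (real^'d). fst z *v snd z)"
    unfolding matrix_vector_mult_def by (intro continuous_intros)
  then have "(\<lambda>z::(real^'d^'d) \<times> (real^'d). fst z *v snd z) \<in> borel_measurable borel"
    by (rule borel_measurable_continuous_onI)
  then show ?thesis by (simp add: borel_prod)
qed

lemma measurable_mult_mat_pair:
  "(\<lambda>z::(real^'d^'d) \<times> (real^'d^'d). fst z ** snd z) \<in> borel \<Otimes>\<^sub>M borel \<rightarrow>\<^sub>M borel"
proof -
  have "continuous_on UNIV (\<lambda>z::(real^'d^'d) \<times> (real^'d^'d). fst z ** snd z)"
    unfolding matrix_matrix_mult_def by (intro continuous_intros)
  then have "(\<lambda>z::(real^'d^'d) \<times> (real^'d^'d). fst z ** snd z) \<in> borel_measurable borel"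
    by (rule borel_measurable_continuous_onI)
  then show ?thesis by (simp add: borel_prod)
qed

lemma measurable_transpose: "transpose \<in> borel \<rightarrow>\<^sub>M (borel :: (real^'d^'d) measure)"
proof -
  have "continuous_on UNIV (transpose :: real^'d^'d \<Rightarrow> _)"
    unfolding transpose_def[abs_def] by (intro continuous_intros)
  then show ?thesis by (rule borel_measurable_continuous_onI)
qed

lemma measurable_mult_vec: "(\<lambda>x. Q *v x) \<in> borel \<rightarrow>\<^sub>M (borel :: (real^'d) measure)"
  for Q :: "real^'d^'d"
  by (intro borel_measurable_continuous_onI matrix_vector_mult_linear_continuous_on)

lemma nn_integral_lborel_translate:
  fixes h :: "'a::euclidean_space \<Rightarrow> ennreal"
  assumes [measurable]: "h \<in> borel_measurable borel"
  shows "(\<integral>\<^sup>+x. h (c + x) \<partial>lborel) = (\<integral>\<^sup>+x. h x \<partial>lborel)"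
proof -
  have "(\<integral>\<^sup>+x. h x \<partial>lborel) = (\<integral>\<^sup>+x. h x \<partial>(distr lborel borel ((+) c)))"
    by (simp add: lborel_distr_plus)
  also have "\<dots> = (\<integral>\<^sup>+x. h (c + x) \<partial>lborel)"
    by (rule nn_integral_distr) auto
  finally show ?thesis by simp
qed

text \<open>The push-forward of Lebesgue measure under a rotation is translation invariant and agrees
  with Lebesgue measure on the unit ball \<open>B\<close>; uniqueness of such a measure is obtained by inserting
  the volume of a translate of \<open>B\<close> and exchanging the integrals.\<close>

lemma nn_integral_lborel_rotation:
  fixes Q :: "real^'d^'d"
  assumes Q: "Q \<in> SO" and h [measurable]: "h \<in> borel_measurable borel"
  shows "(\<integral>\<^sup>+x. h (Q *v x) \<partial>lborel) = (\<integral>\<^sup>+x. h x \<partial>lborel)"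
proof -
  let ?B = "ball (0::real^'d) 1"
  let ?i = "\<lambda>x. indicator ?B x :: ennreal"
  have B: "emeasure lborel ?B \<noteq> 0" "emeasure lborel ?B \<noteq> \<infinity>"
    using unit_ball_vol_pos[of "real CARD('d)"] by (auto simp: emeasure_ball simp del: unit_ball_vol_pos)
  note [measurable] = measurable_mult_vec[of Q]
  have [measurable]: "?B \<in> sets borel" by simp
  have [measurable]: "?i \<in> borel_measurable borel" by simp
  have m: "(\<lambda>(x, y). h (Q *v x) * ?i (y - Q *v x)) \<in> borel_measurable (lborel \<Otimes>\<^sub>M lborel)"
    by (simp add: case_prod_beta)
  have m': "(\<lambda>(x, y). h (y + Q *v x) * ?i (- (Q *v x))) \<in> borel_measurable (lborel \<Otimes>\<^sub>M lborel)"
    by (simp add: case_prod_beta)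
  have "(\<integral>\<^sup>+x. h (Q *v x) \<partial>lborel) * emeasure lborel ?B
      = (\<integral>\<^sup>+x. h (Q *v x) * emeasure lborel ?B \<partial>lborel)"
    by (rule nn_integral_multc[symmetric]) simp
  also have "\<dots> = (\<integral>\<^sup>+x. (\<integral>\<^sup>+y. h (Q *v x) * ?i (y - Q *v x) \<partial>lborel) \<partial>lborel)"
  proof (rule nn_integral_cong)
    fix x :: "real^'d"
    have "(\<integral>\<^sup>+y. ?i (y - Q *v x) \<partial>lborel) = emeasure lborel ?B"
      using nn_integral_lborel_translate[of ?i "- (Q *v x)"] by simp
    then show "h (Q *v x) * emeasure lborel ?B = (\<integral>\<^sup>+y. h (Q *v x) * ?i (y - Q *v x) \<partial>lborel)"
      by (subst nn_integral_cmult) auto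
  qed
  also have "\<dots> = (\<integral>\<^sup>+y. (\<integral>\<^sup>+x. h (Q *v x) * ?i (y - Q *v x) \<partial>lborel) \<partial>lborel)"
    using lborel_pair.Fubini'[OF m] by simp
  also have "\<dots> = (\<integral>\<^sup>+y. (\<integral>\<^sup>+x. h (y + Q *v x) * ?i (- (Q *v x)) \<partial>lborel) \<partial>lborel)"
  proof (rule nn_integral_cong)
    fix y :: "real^'d"
    have "Q *v (matrix_inv Q *v y) = y"
      by (simp add: SO_matrix_inv[OF Q] matrix_vector_mul_assoc SO_transpose_mult[OF Q]
          del: transpose_matrix_vector)
    then show "(\<integral>\<^sup>+x. h (Q *v x) * ?i (y - Q *v x) \<partial>lborel)
        = (\<integral>\<^sup>+x. h (y + Q *v x) * ?i (- (Q *v x)) \<partial>lborel)"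
      using nn_integral_lborel_translate[of "\<lambda>x. h (Q *v x) * ?i (y - Q *v x)" "matrix_inv Q *v y"]
      by (simp add: matrix_vector_right_distrib)
  qed
  also have "\<dots> = (\<integral>\<^sup>+x. (\<integral>\<^sup>+y. h (y + Q *v x) * ?i (- (Q *v x)) \<partial>lborel) \<partial>lborel)"
    using lborel_pair.Fubini'[OF m'] by simp
  also have "\<dots> = (\<integral>\<^sup>+x. (\<integral>\<^sup>+y. h y \<partial>lborel) * ?i x \<partial>lborel)"
  proof (rule nn_integral_cong)
    fix x :: "real^'d"
    have "?i (- (Q *v x)) = ?i x" by (simp add: indicator_def SO_norm[OF Q])
    then show "(\<integral>\<^sup>+y. h (y + Q *v x) * ?i (- (Q *v x)) \<partial>lborel) = (\<integral>\<^sup>+y. h y \<partial>lborel) * ?i x"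
      using nn_integral_lborel_translate[OF h, of "Q *v x"]
      by (subst nn_integral_multc) (auto simp: add.commute)
  qed
  also have "\<dots> = (\<integral>\<^sup>+y. h y \<partial>lborel) * emeasure lborel ?B"
    by (subst nn_integral_cmult) auto
  finally have "(\<integral>\<^sup>+x. h (Q *v x) \<partial>lborel) * emeasure lborel ?B / emeasure lborel ?B
      = (\<integral>\<^sup>+y. h y \<partial>lborel) * emeasure lborel ?B / emeasure lborel ?B"
    by (rule arg_cong)
  then show ?thesis
    by (simp only: ennreal_mult_divide_eq[OF B(1) B(2)[unfolded infinity_ennreal_def]])
qed

section \<open>Haar measure on the rotation group\<close>

locale haar_SO =
  fixes \<mu> :: "(real^'d^'d) measure"
  assumes haar: "is_haar_SO \<mu>"
begin

lemma prob: "prob_space \<mu>" and sets_mu: "sets \<mu> = sets (restrict_space borel SO)"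
  and left_inv: "Q \<in> SO \<Longrightarrow> distr \<mu> \<mu> (\<lambda>g. Q ** g) = \<mu>"
  using haar by (auto simp: is_haar_SO_def)

interpretation prob_space \<mu> by (rule prob)

lemma space_mu: "space \<mu> = SO"
  using sets_eq_imp_space_eq[OF sets_mu] by (simp add: space_restrict_space)

lemma measurable_into_mu:
  assumes "h \<in> M \<rightarrow>\<^sub>M borel" "h \<in> space M \<rightarrow> SO"
  shows "h \<in> M \<rightarrow>\<^sub>M \<mu>"
  using measurable_restrict_space2[OF assms(2,1)] measurable_cong_sets[OF refl sets_mu] by auto

lemma measurable_id_mu [measurable]: "(\<lambda>g. g) \<in> \<mu> \<rightarrow>\<^sub>M borel"
  using measurable_cong_sets[OF sets_mu refl, of borel]
    measurable_restrict_space1[OF measurable_ident, of borel SO] by (auto simp: id_def)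

lemma measurable_action [measurable]: "(\<lambda>z. fst z *v snd z) \<in> \<mu> \<Otimes>\<^sub>M borel \<rightarrow>\<^sub>M borel"
proof -
  have "(\<lambda>z. (fst z, snd z)) \<in> \<mu> \<Otimes>\<^sub>M borel \<rightarrow>\<^sub>M borel \<Otimes>\<^sub>M (borel :: (real^'d) measure)"
    by measurable
  from measurable_compose[OF this measurable_mult_vec_pair] show ?thesis by simp
qed

lemma measurable_orbit [measurable]: "(\<lambda>g. g *v x) \<in> \<mu> \<rightarrow>\<^sub>M borel"
proof -
  have "(\<lambda>g. (g, x)) \<in> \<mu> \<rightarrow>\<^sub>M \<mu> \<Otimes>\<^sub>M borel" by measurable
  from measurable_compose[OF this measurable_action] show ?thesis by simp
qed

lemma measurable_mu_mult: "(\<lambda>z. fst z ** snd z) \<in> \<mu> \<Otimes>\<^sub>M \<mu> \<rightarrow>\<^sub>M \<mu>"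
proof (rule measurable_into_mu)
  have "(\<lambda>z. (fst z, snd z)) \<in> \<mu> \<Otimes>\<^sub>M \<mu> \<rightarrow>\<^sub>M borel \<Otimes>\<^sub>M (borel :: (real^'d^'d) measure)"
    by measurable
  from measurable_compose[OF this measurable_mult_mat_pair]
  show "(\<lambda>z. fst z ** snd z) \<in> borel_measurable (\<mu> \<Otimes>\<^sub>M \<mu>)" by simp
qed (auto simp: space_pair_measure space_mu intro: SO_mult)

lemma measurable_left_mult: "Q \<in> SO \<Longrightarrow> (\<lambda>g. Q ** g) \<in> \<mu> \<rightarrow>\<^sub>M \<mu>"
  by (rule measurable_compose[OF _ measurable_mu_mult, of "\<lambda>g. (Q, g)", simplified])
     (simp add: measurable_Pair space_mu)

lemma measurable_mu_transpose: "transpose \<in> \<mu> \<rightarrow>\<^sub>M \<mu>"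
  by (rule measurable_into_mu)
     (auto simp: space_mu intro: SO_transpose measurable_compose[OF measurable_id_mu measurable_transpose])

lemma nn_integral_left:
  assumes "Q \<in> SO" and [measurable]: "F \<in> borel_measurable \<mu>"
  shows "(\<integral>\<^sup>+g. F (Q ** g) \<partial>\<mu>) = (\<integral>\<^sup>+g. F g \<partial>\<mu>)"
  by (metis (no_types) assms left_inv nn_integral_distr measurable_left_mult)

text \<open>Left invariance and Fubini turn the average of \<open>F (g\<^sup>-\<^sup>1 h)\<close> over both variables into either
  the average of \<open>F\<close> or that of \<open>F\<close> composed with inversion; right invariance is a consequence.\<close>

lemma nn_integral_inverse:
  assumes [measurable]: "F \<in> borel_measurable \<mu>"
  shows "(\<integral>\<^sup>+g. F (transpose g) \<partial>\<mu>) = (\<integral>\<^sup>+g. F g \<partial>\<mu>)"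
proof -
  note [measurable] = measurable_mu_mult measurable_mu_transpose
  interpret pair_sigma_finite \<mu> \<mu> by unfold_locales
  have m: "(\<lambda>(g, h). F (transpose g ** h)) \<in> borel_measurable (\<mu> \<Otimes>\<^sub>M \<mu>)"
  proof -
    have "(\<lambda>z. (transpose (fst z), snd z)) \<in> \<mu> \<Otimes>\<^sub>M \<mu> \<rightarrow>\<^sub>M \<mu> \<Otimes>\<^sub>M \<mu>" by measurable
    from measurable_compose[OF measurable_compose[OF this measurable_mu_mult] assms]
    show ?thesis by (simp add: case_prod_beta)
  qed
  have "(\<integral>\<^sup>+g. F g \<partial>\<mu>) = (\<integral>\<^sup>+g. (\<integral>\<^sup>+h. F h \<partial>\<mu>) \<partial>\<mu>)"
    by (simp add: emeasure_space_1)
  also have "\<dots> = (\<integral>\<^sup>+g. (\<integral>\<^sup>+h. F (transpose g ** h) \<partial>\<mu>) \<partial>\<mu>)"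
    by (intro nn_integral_cong nn_integral_left[symmetric] SO_transpose) (auto simp: space_mu)
  also have "\<dots> = (\<integral>\<^sup>+h. (\<integral>\<^sup>+g. F (transpose g ** h) \<partial>\<mu>) \<partial>\<mu>)"
    using Fubini'[OF m] by simp
  also have "\<dots> = (\<integral>\<^sup>+h. (\<integral>\<^sup>+g. F (transpose (transpose h ** g)) \<partial>\<mu>) \<partial>\<mu>)"
    by (simp add: matrix_transpose_mul transpose_transpose)
  also have "\<dots> = (\<integral>\<^sup>+h. (\<integral>\<^sup>+g. F (transpose g) \<partial>\<mu>) \<partial>\<mu>)"
    by (intro nn_integral_cong nn_integral_left[where F="\<lambda>g. F (transpose g)"] SO_transpose)
       (auto simp: space_mu)
  finally show ?thesis by (simp add: emeasure_space_1)
qed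

lemma nn_integral_right:
  assumes Q: "Q \<in> SO" and [measurable]: "F \<in> borel_measurable \<mu>"
  shows "(\<integral>\<^sup>+g. F (g ** Q) \<partial>\<mu>) = (\<integral>\<^sup>+g. F g \<partial>\<mu>)"
proof -
  note [measurable] = measurable_mu_mult measurable_mu_transpose
  have mr: "(\<lambda>g. F (g ** Q)) \<in> borel_measurable \<mu>"
  proof -
    have "(\<lambda>g. (g, Q)) \<in> \<mu> \<rightarrow>\<^sub>M \<mu> \<Otimes>\<^sub>M \<mu>" using Q by (simp add: measurable_Pair space_mu)
    from measurable_compose[OF measurable_compose[OF this measurable_mu_mult] assms(2)]
    show ?thesis by simp
  qed
  have "(\<integral>\<^sup>+g. F (g ** Q) \<partial>\<mu>) = (\<integral>\<^sup>+g. F (transpose g ** Q) \<partial>\<mu>)"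
    using nn_integral_inverse[OF mr] by simp
  also have "\<dots> = (\<integral>\<^sup>+g. F (transpose (transpose Q ** g)) \<partial>\<mu>)"
    by (simp add: matrix_transpose_mul transpose_transpose)
  also have "\<dots> = (\<integral>\<^sup>+g. F (transpose g) \<partial>\<mu>)"
    by (rule nn_integral_left[where F="\<lambda>g. F (transpose g)"]) (auto intro: SO_transpose Q)
  finally show ?thesis by (simp add: nn_integral_inverse)
qed

text \<open>Averaging over the orbits of the rotation group does not change a Lebesgue integral; this
  replaces integration in polar coordinates.\<close>

lemma nn_integral_lborel_orbit_average:
  assumes [measurable]: "h \<in> borel_measurable borel"
  shows "(\<integral>\<^sup>+x. h x \<partial>lborel) = (\<integral>\<^sup>+x. (\<integral>\<^sup>+g. h (g *v x) \<partial>\<mu>) \<partial>lborel)"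
proof -
  interpret pair_sigma_finite \<mu> "lborel :: (real^'d) measure" by unfold_locales
  have m: "(\<lambda>(g, x). h (g *v x)) \<in> borel_measurable (\<mu> \<Otimes>\<^sub>M lborel)"
    using measurable_compose[OF measurable_action assms] by (simp add: case_prod_beta)
  have "(\<integral>\<^sup>+x. h x \<partial>lborel) = (\<integral>\<^sup>+g. (\<integral>\<^sup>+x. h x \<partial>lborel) \<partial>\<mu>)"
    by (simp add: emeasure_space_1)
  also have "\<dots> = (\<integral>\<^sup>+g. (\<integral>\<^sup>+x. h (g *v x) \<partial>lborel) \<partial>\<mu>)"
  proof (rule nn_integral_cong)
    fix g assume "g \<in> space \<mu>"
    then have "g \<in> SO" by (simp add: space_mu)
    then show "(\<integral>\<^sup>+x. h x \<partial>lborel) = (\<integral>\<^sup>+x. h (g *v x) \<partial>lborel)"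
      by (simp add: nn_integral_lborel_rotation)
  qed
  also have "\<dots> = (\<integral>\<^sup>+x. (\<integral>\<^sup>+g. h (g *v x) \<partial>\<mu>) \<partial>lborel)"
    using Fubini'[OF m] by simp
  finally show ?thesis .
qed

definition orbit_mean :: "(real^'d \<Rightarrow> real) \<Rightarrow> real^'d \<Rightarrow> real" where
  "orbit_mean h x = (LINT g|\<mu>. h (g *v x))"

lemma orbit_mean_rotate:
  assumes [measurable]: "h \<in> borel_measurable borel" and pos: "\<And>x. 0 \<le> h x" and Q: "Q \<in> SO"
  shows "orbit_mean h (Q *v x) = orbit_mean h x"
proof -
  have "(\<integral>\<^sup>+g. h (g *v (Q *v x)) \<partial>\<mu>) = (\<integral>\<^sup>+g. h (g *v x) \<partial>\<mu>)"
    using nn_integral_right[OF Q, of "\<lambda>g. ennreal (h (g *v x))"]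
    by (simp add: matrix_vector_mul_assoc)
  then show ?thesis
    unfolding orbit_mean_def using pos by (simp add: integral_eq_nn_integral)
qed

lemma orbit_mean_norm:
  assumes "CARD('d) \<ge> 2" "h \<in> borel_measurable borel" "\<And>x. 0 \<le> h x" "norm x = norm y"
  shows "orbit_mean h x = orbit_mean h y"
  using SO_transitive[OF assms(1) assms(4)] orbit_mean_rotate[OF assms(2,3)] by metis

lemma measurable_orbit_mean [measurable]:
  assumes "h \<in> borel_measurable borel"
  shows "orbit_mean h \<in> borel_measurable borel"
proof -
  have "(\<lambda>z. (snd z, fst z)) \<in> borel \<Otimes>\<^sub>M \<mu> \<rightarrow>\<^sub>M \<mu> \<Otimes>\<^sub>M (borel :: (real^'d) measure)"
    by measurable
  from measurable_compose[OF measurable_compose[OF this measurable_action] assms]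
  show ?thesis unfolding orbit_mean_def[abs_def]
    by (intro borel_measurable_lebesgue_integral) (simp add: case_prod_beta)
qed

text \<open>The surface measure is the image of the uniform distribution on the ball under \<open>sgn\<close>, so the
  spherical mean is a Lebesgue integral over the ball.  Averaged over orbits, its integrand becomes
  constant away from the origin.\<close>

lemma orbit_mean_sphere:
  assumes d: "CARD('d) \<ge> 2" and h [measurable]: "h \<in> borel_measurable borel"
    and h01: "\<And>x. 0 \<le> h x" "\<And>x. h x \<le> 1" and s: "s > 0" and x: "norm x = s"
  shows "orbit_mean h x = (LINT \<omega>|sphere_measure. h (s *\<^sub>R \<omega>))"
proof -
  let ?U = "uniform_measure lborel (ball (0::real^'d) 1)"
  let ?c = "orbit_mean h x" and ?B = "ball (0::real^'d) 1"
  have B: "emeasure lborel ?B \<noteq> 0" "emeasure lborel ?B \<noteq> \<infinity>"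
    using unit_ball_vol_pos[of "real CARD('d)"] by (auto simp: emeasure_ball simp del: unit_ball_vol_pos)
  have [measurable]: "(sgn :: real^'d \<Rightarrow> _) \<in> borel_measurable borel"
    unfolding sgn_div_norm[abs_def] by measurable
  have [measurable]: "?B \<in> sets borel" by simp
  have orb: "(\<integral>\<^sup>+g. ennreal (h (s *\<^sub>R sgn (g *v y))) * indicator ?B (g *v y) \<partial>\<mu>) = ennreal ?c * indicator ?B y"
    if "y \<noteq> 0" for y
  proof -
    have "(\<integral>\<^sup>+g. ennreal (h (s *\<^sub>R sgn (g *v y))) * indicator ?B (g *v y) \<partial>\<mu>)
        = (\<integral>\<^sup>+g. ennreal (h (g *v (s *\<^sub>R sgn y))) * indicator ?B y \<partial>\<mu>)"
    proof (rule nn_integral_cong)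
      fix g assume "g \<in> space \<mu>"
      then have "norm (g *v y) = norm y" by (simp add: space_mu SO_norm)
      then show "ennreal (h (s *\<^sub>R sgn (g *v y))) * indicator ?B (g *v y)
          = ennreal (h (g *v (s *\<^sub>R sgn y))) * indicator ?B y"
        by (simp add: sgn_div_norm matrix_vector_mult_scaleR indicator_def)
    qed
    also have "\<dots> = (\<integral>\<^sup>+g. ennreal (h (g *v (s *\<^sub>R sgn y))) \<partial>\<mu>) * indicator ?B y"
      by (rule nn_integral_multc) simp
    also have "(\<integral>\<^sup>+g. ennreal (h (g *v (s *\<^sub>R sgn y))) \<partial>\<mu>) = ennreal (orbit_mean h (s *\<^sub>R sgn y))"
      unfolding orbit_mean_def
      by (intro nn_integral_eq_integral integrable_const_bound[where B=1]) (auto simp: h01)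
    also have "orbit_mean h (s *\<^sub>R sgn y) = ?c"
      using that s x by (intro orbit_mean_norm d h h01(1)) (simp add: norm_sgn)
    finally show ?thesis .
  qed
  have "(\<integral>\<^sup>+\<omega>. h (s *\<^sub>R \<omega>) \<partial>(sphere_measure :: (real^'d) measure)) = (\<integral>\<^sup>+y. h (s *\<^sub>R sgn y) \<partial>?U)"
    unfolding sphere_measure_def by (subst nn_integral_distr) auto
  also have "\<dots> = (\<integral>\<^sup>+y. ennreal (h (s *\<^sub>R sgn y)) * indicator ?B y \<partial>lborel) / emeasure lborel ?B"
    by (subst nn_integral_uniform_measure) auto
  also have "(\<integral>\<^sup>+y. ennreal (h (s *\<^sub>R sgn y)) * indicator ?B y \<partial>lborel)
      = (\<integral>\<^sup>+y. (\<integral>\<^sup>+g. ennreal (h (s *\<^sub>R sgn (g *v y))) * indicator ?B (g *v y) \<partial>\<mu>) \<partial>lborel)"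
    by (rule nn_integral_lborel_orbit_average) measurable
  also have "\<dots> = (\<integral>\<^sup>+y. ennreal ?c * indicator ?B y \<partial>lborel)"
  proof (rule nn_integral_cong_AE)
    have "AE y in lborel. y \<noteq> (0::real^'d)" by (rule AE_lborel_singleton)
    then show "AE y in lborel. (\<integral>\<^sup>+g. ennreal (h (s *\<^sub>R sgn (g *v y))) * indicator ?B (g *v y) \<partial>\<mu>)
        = ennreal ?c * indicator ?B y"
      by eventually_elim (rule orb)
  qed
  also have "\<dots> / emeasure lborel ?B = ennreal ?c"
    using B by (simp add: nn_integral_cmult_indicator ennreal_mult_divide_eq)
  finally have nn: "(\<integral>\<^sup>+\<omega>. h (s *\<^sub>R \<omega>) \<partial>(sphere_measure :: (real^'d) measure)) = ennreal ?c" .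
  have "?c \<ge> 0" unfolding orbit_mean_def by (simp add: h01)
  then show ?thesis
    using nn by (subst integral_eq_nn_integral) (auto simp: h01 sphere_measure_def)
qed

end

section \<open>Rotation averages and their contraction in mean square\<close>

lemma weighted_mean_square:
  fixes c x :: "'i \<Rightarrow> real"
  assumes "\<And>i. i \<in> I \<Longrightarrow> 0 \<le> c i" "(\<Sum>i\<in>I. c i) = 1"
  shows "(\<Sum>i\<in>I. c i * x i)\<^sup>2 \<le> (\<Sum>i\<in>I. c i * (x i)\<^sup>2)"
proof -
  have "(\<Sum>i\<in>I. c i * x i) = (\<Sum>i\<in>I. sqrt (c i) * (sqrt (c i) * x i))"
    using assms(1) by (intro sum.cong) (auto simp: mult.assoc[symmetric])
  then have "(\<Sum>i\<in>I. c i * x i)\<^sup>2 \<le> (\<Sum>i\<in>I. (sqrt (c i))\<^sup>2) * (\<Sum>i\<in>I. (sqrt (c i) * x i)\<^sup>2)"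
    using Cauchy_Schwarz_ineq_sum by metis
  also have "\<dots> = (\<Sum>i\<in>I. c i) * (\<Sum>i\<in>I. c i * (x i)\<^sup>2)"
    using assms(1) by (simp add: power_mult_distrib)
  finally show ?thesis using assms(2) by simp
qed

locale rotation_walk = haar_SO \<mu> for \<mu> :: "(real^'d^'d) measure" +
  fixes n :: nat and r p :: "nat \<Rightarrow> real" and Q :: "nat \<Rightarrow> real^'d^'d"
  assumes Q_SO: "i \<in> {1..n} \<Longrightarrow> Q i \<in> SO"
    and p_pos: "i \<in> {1..n} \<Longrightarrow> p i > 0"
begin

interpretation prob_space \<mu> by (rule prob)

abbreviation levels :: "real set" where
  "levels \<equiv> (\<lambda>i. \<bar>r i\<bar>) ` {1..n}"

abbreviation weight :: "real \<Rightarrow> real" where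
  "weight a \<equiv> level_weight n r p a"

abbreviation gap :: "real \<Rightarrow> real" where
  "gap a \<equiv> op_norm_zero_mean \<mu> (markov_op n r p Q a)"

text \<open>This is the Markov operator of level \<open>a\<close> transported to functions on Euclidean space: applied to
  \<open>g \<mapsto> h (g x)\<close>, the operator gives \<open>g \<mapsto> rot_avg a h (g x)\<close> for every \<open>x\<close>.\<close>

definition rot_avg :: "real \<Rightarrow> (real^'d \<Rightarrow> real) \<Rightarrow> real^'d \<Rightarrow> real" where
  "rot_avg a h x = (\<Sum>i\<in>level_set n r a. p i / weight a * h (matrix_inv (Q i) *v x))"

definition rot_avgs :: "real list \<Rightarrow> (real^'d \<Rightarrow> real) \<Rightarrow> real^'d \<Rightarrow> real" where
  "rot_avgs w h = foldr rot_avg w h"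

lemma finite_level_set: "finite (level_set n r a)"
  by (auto simp: level_set_def)

lemma inv_SO: "i \<in> level_set n r a \<Longrightarrow> matrix_inv (Q i) \<in> SO"
  by (intro SO_matrix_inv_in Q_SO) (auto simp: level_set_def)

lemma weight_nonneg: "weight a \<ge> 0"
  unfolding level_weight_def by (intro sum_nonneg less_imp_le p_pos) (auto simp: level_set_def)

lemma weight_pos: "a \<in> levels \<Longrightarrow> weight a > 0"
  unfolding level_weight_def using p_pos
  by (intro sum_pos finite_level_set) (auto simp: level_set_def)

lemma coeff_nonneg: "i \<in> level_set n r a \<Longrightarrow> 0 \<le> p i / weight a"
  by (intro divide_nonneg_nonneg weight_nonneg less_imp_le p_pos) (auto simp: level_set_def)

lemma coeff_sum: "a \<in> levels \<Longrightarrow> (\<Sum>i\<in>level_set n r a. p i / weight a) = 1"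
  using weight_pos[of a] by (simp add: sum_divide_distrib[symmetric] level_weight_def[symmetric])

lemma measurable_rot_avg [measurable]:
  assumes h: "h \<in> borel_measurable borel"
  shows "rot_avg a h \<in> borel_measurable borel"
proof -
  have [measurable]: "(\<lambda>x. h (M *v x)) \<in> borel_measurable borel" for M :: "real^'d^'d"
    by (rule measurable_compose[OF measurable_mult_vec h])
  show ?thesis unfolding rot_avg_def[abs_def] by measurable
qed

lemma measurable_rot_avgs [measurable]:
  "h \<in> borel_measurable borel \<Longrightarrow> rot_avgs w h \<in> borel_measurable borel"
  unfolding rot_avgs_def by (induction w) auto

lemma rot_avgs_simps: "rot_avgs [] h = h" "rot_avgs (a # w) h = rot_avg a (rot_avgs w h)"
  "rot_avgs (w @ [a]) h = rot_avgs w (rot_avg a h)"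
  by (auto simp: rot_avgs_def)

lemma integral_left:
  fixes F :: "_ \<Rightarrow> 'b::{banach, second_countable_topology}"
  assumes "P \<in> SO" "F \<in> borel_measurable \<mu>"
  shows "(LINT g|\<mu>. F (P ** g)) = (LINT g|\<mu>. F g)"
  using integral_distr[OF measurable_left_mult[OF assms(1)] assms(2)] left_inv[OF assms(1)] by simp

lemma integrable_left:
  fixes F :: "_ \<Rightarrow> 'b::{banach, second_countable_topology}"
  assumes "P \<in> SO" "integrable \<mu> F"
  shows "integrable \<mu> (\<lambda>g. F (P ** g))"
  using integrable_distr[OF measurable_left_mult[OF assms(1)], of F] left_inv[OF assms(1)] assms(2)
  by simp

lemma L2_zero_mean_integrable:
  assumes "F \<in> L2_zero_mean \<mu>"
  shows "integrable \<mu> F"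
proof (rule Bochner_Integration.integrable_bound)
  show "integrable \<mu> (\<lambda>g. 1 + (cmod (F g))\<^sup>2)"
    using assms by (simp add: L2_zero_mean_def)
  have "x \<le> 1 + x\<^sup>2" for x :: real
    using zero_le_power2[of "x - 1/2"] by (simp add: power2_eq_square algebra_simps)
  then show "AE g in \<mu>. norm (F g) \<le> norm (1 + (cmod (F g))\<^sup>2)"
    by simp
qed (use assms in \<open>auto simp: L2_zero_mean_def\<close>)

lemma markov_op_L2:
  assumes a: "a \<in> levels" and F: "F \<in> L2_zero_mean \<mu>"
  shows "markov_op n r p Q a F \<in> L2_zero_mean \<mu>"
    and "L2_norm \<mu> (markov_op n r p Q a F) \<le> L2_norm \<mu> F"
proof -
  let ?I = "level_set n r a" and ?c = "\<lambda>i. p i / weight a"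
  let ?S = "\<lambda>g. \<Sum>i\<in>?I. ?c i * (cmod (F (matrix_inv (Q i) ** g)))\<^sup>2"
  have Fm [measurable]: "F \<in> borel_measurable \<mu>" and F2: "integrable \<mu> (\<lambda>g. (cmod (F g))\<^sup>2)"
    and F0: "(LINT g|\<mu>. F g) = 0"
    using F by (auto simp: L2_zero_mean_def)
  have m: "markov_op n r p Q a F \<in> borel_measurable \<mu>"
  proof -
    have "(\<lambda>g. of_real (?c i) * F (matrix_inv (Q i) ** g)) \<in> borel_measurable \<mu>" if "i \<in> ?I" for i
      using measurable_compose[OF measurable_left_mult[OF inv_SO[OF that]] Fm] by measurable
    then show ?thesis unfolding markov_op_def by (rule borel_measurable_sum)
  qed
  have iS: "integrable \<mu> ?S"
    by (intro Bochner_Integration.integrable_sum integrable_mult_right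
        integrable_left[where F="\<lambda>g. (cmod (F g))\<^sup>2"] inv_SO F2)
  have le: "(cmod (markov_op n r p Q a F g))\<^sup>2 \<le> ?S g" for g
  proof -
    have "cmod (markov_op n r p Q a F g)
        \<le> (\<Sum>i\<in>?I. cmod (of_real (?c i) * F (matrix_inv (Q i) ** g)))"
      unfolding markov_op_def by (rule norm_sum)
    also have "\<dots> = (\<Sum>i\<in>?I. ?c i * cmod (F (matrix_inv (Q i) ** g)))"
      by (intro sum.cong refl)
         (simp only: norm_mult norm_of_real abs_of_nonneg[OF coeff_nonneg])
    finally have "(cmod (markov_op n r p Q a F g))\<^sup>2 \<le> (\<Sum>i\<in>?I. ?c i * cmod (F (matrix_inv (Q i) ** g)))\<^sup>2"
      by (intro power_mono) auto
    also have "\<dots> \<le> ?S g"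
      by (intro weighted_mean_square coeff_nonneg coeff_sum a)
    finally show ?thesis .
  qed
  have i2: "integrable \<mu> (\<lambda>g. (cmod (markov_op n r p Q a F g))\<^sup>2)"
    using m le by (intro Bochner_Integration.integrable_bound[OF iS]) (auto intro: order_trans[OF _ abs_ge_self])
  have "(LINT g|\<mu>. markov_op n r p Q a F g) = 
      (\<Sum>i\<in>?I. of_real (?c i) * (LINT g|\<mu>. F (matrix_inv (Q i) ** g)))"
    unfolding markov_op_def
    by (subst Bochner_Integration.integral_sum)
       (auto intro!: integrable_mult_right integrable_left inv_SO L2_zero_mean_integrable[OF F])
  also have "\<dots> = 0"
    by (intro sum.neutral ballI) (simp add: integral_left[OF inv_SO Fm] F0)
  finally show "markov_op n r p Q a F \<in> L2_zero_mean \<mu>"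
    using m i2 by (simp add: L2_zero_mean_def)
  have "(LINT g|\<mu>. (cmod (markov_op n r p Q a F g))\<^sup>2) \<le> (LINT g|\<mu>. ?S g)"
    by (intro integral_mono i2 iS le)
  also have "\<dots> = (\<Sum>i\<in>?I. ?c i * (LINT g|\<mu>. (cmod (F (matrix_inv (Q i) ** g)))\<^sup>2))"
    by (subst Bochner_Integration.integral_sum)
       (auto intro!: integrable_mult_right integrable_left[where F="\<lambda>g. (cmod (F g))\<^sup>2"] inv_SO F2
         simp del: times_divide_eq_left)
  also have "\<dots> = (\<Sum>i\<in>?I. ?c i * (LINT g|\<mu>. (cmod (F g))\<^sup>2))"
    by (intro sum.cong refl arg_cong2[where f="(*)"] integral_left[where F="\<lambda>g. (cmod (F g))\<^sup>2"] inv_SO)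
       measurable
  also have "\<dots> = (LINT g|\<mu>. (cmod (F g))\<^sup>2)"
    by (simp only: sum_distrib_right[symmetric] coeff_sum[OF a] mult_1)
  finally show "L2_norm \<mu> (markov_op n r p Q a F) \<le> L2_norm \<mu> F"
    by (simp add: L2_norm_def)
qed

lemma gap_bound:
  assumes "a \<in> levels" "F \<in> L2_zero_mean \<mu>" "L2_norm \<mu> F \<le> 1"
  shows "L2_norm \<mu> (markov_op n r p Q a F) \<le> gap a"
  unfolding op_norm_zero_mean_def
proof (rule cSup_upper)
  show "bdd_above {L2_norm \<mu> (markov_op n r p Q a F) |F. F \<in> L2_zero_mean \<mu> \<and> L2_norm \<mu> F \<le> 1}"
    using markov_op_L2(2)[OF assms(1)] by (force intro!: bdd_aboveI[where M=1])
qed (use assms in blast)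

lemma gap_nonneg:
  assumes "a \<in> levels"
  shows "gap a \<ge> 0"
proof -
  have "(\<lambda>_. 0) \<in> L2_zero_mean \<mu>" "L2_norm \<mu> (\<lambda>_. 0) \<le> 1"
    by (auto simp: L2_zero_mean_def L2_norm_def)
  then have "L2_norm \<mu> (markov_op n r p Q a (\<lambda>_. 0)) \<le> gap a"
    by (rule gap_bound[OF assms])
  then show ?thesis by (simp add: L2_norm_def markov_op_def)
qed

text \<open>The operator norm is a supremum over functions of norm at most \<open>1\<close>.  Scaling covers all others
  but those of norm \<open>0\<close>, which \<open>markov_op_L2\<close> maps to functions of norm \<open>0\<close>.\<close>

lemma markov_op_contraction:
  assumes a: "a \<in> levels" and F: "F \<in> L2_zero_mean \<mu>"
  shows "L2_norm \<mu> (markov_op n r p Q a F) \<le> gap a * L2_norm \<mu> F"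
proof (cases "L2_norm \<mu> F = 0")
  case True
  then show ?thesis using markov_op_L2(2)[OF assms] by simp
next
  case False
  let ?N = "L2_norm \<mu> F"
  have pos: "?N > 0" using False by (simp add: L2_norm_def order_less_le)
  have scale: "L2_norm \<mu> (\<lambda>g. of_real c * G g) = c * L2_norm \<mu> G" if "c \<ge> 0" for c G
    using that by (simp add: L2_norm_def norm_mult power_mult_distrib real_sqrt_mult)
  let ?G = "\<lambda>g. of_real (1 / ?N) * F g"
  have "?G \<in> L2_zero_mean \<mu>"
    using F by (auto simp: L2_zero_mean_def norm_mult power_mult_distrib norm_divide power_divide)
  moreover have "L2_norm \<mu> ?G \<le> 1"
    using pos by (subst scale) auto
  ultimately have "L2_norm \<mu> (markov_op n r p Q a ?G) \<le> gap a"
    by (rule gap_bound[OF a])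
  also have "markov_op n r p Q a ?G = (\<lambda>g. of_real (1 / ?N) * markov_op n r p Q a F g)"
    unfolding markov_op_def by (simp add: sum_distrib_left mult_ac)
  also have "L2_norm \<mu> \<dots> = 1 / ?N * L2_norm \<mu> (markov_op n r p Q a F)"
    using pos by (intro scale) auto
  finally show ?thesis using pos by (simp add: field_simps)
qed

text \<open>Averages along a word act on the restriction of a function to one orbit as a product of
  Markov operators; the operators fix constants, so the deviation from the orbit mean is what they
  contract.\<close>

lemma rot_avgs_deviation:
  assumes w: "set w \<subseteq> levels" and h [measurable]: "h \<in> borel_measurable borel"
    and h01: "\<And>x. 0 \<le> h x" "\<And>x. h x \<le> 1"
  shows "(\<lambda>g. complex_of_real (rot_avgs w h (g *v x) - orbit_mean h x)) \<in> L2_zero_mean \<mu> \<and>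
    L2_norm \<mu> (\<lambda>g. complex_of_real (rot_avgs w h (g *v x) - orbit_mean h x)) \<le> (\<Prod>a\<leftarrow>w. gap a)"
    (is "?F w \<in> _ \<and> _")
  using w
proof (induction w)
  case Nil
  let ?c = "orbit_mean h x"
  have ih: "integrable \<mu> (\<lambda>g. h (g *v x))"
    by (rule integrable_const_bound[where B=1]) (auto simp: h01)
  have "0 \<le> ?c" "?c \<le> 1"
    unfolding orbit_mean_def using integral_mono[OF ih, of "\<lambda>_. 1"]
    by (auto simp: h01 prob_space)
  then have b: "\<bar>h y - ?c\<bar> \<le> 1" for y
    using h01[of y] by (auto simp: abs_le_iff)
  then have b2: "(h y - ?c)\<^sup>2 \<le> 1" for y
    by (simp add: abs_square_le_1)
  have i2: "integrable \<mu> (\<lambda>g. (h (g *v x) - ?c)\<^sup>2)"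
    by (rule integrable_const_bound[where B=1]) (auto simp: b2)
  have z: "(LINT g|\<mu>. complex_of_real (h (g *v x) - ?c)) = 0"
    unfolding integral_complex_of_real using ih by (simp add: orbit_mean_def prob_space)
  have "(LINT g|\<mu>. (h (g *v x) - ?c)\<^sup>2) \<le> 1"
    using integral_mono[OF i2, of "\<lambda>_. 1"] b2 by (simp add: prob_space)
  then have "?F [] \<in> L2_zero_mean \<mu>" "L2_norm \<mu> (?F []) \<le> 1"
    using i2 z by (auto simp: L2_zero_mean_def L2_norm_def rot_avgs_simps simp del: of_real_diff)
  then show ?case by simp
next
  case (Cons a w)
  then have a: "a \<in> levels" and IH: "?F w \<in> L2_zero_mean \<mu>" "L2_norm \<mu> (?F w) \<le> (\<Prod>a\<leftarrow>w. gap a)"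
    by auto
  have "?F (a # w) = markov_op n r p Q a (?F w)"
  proof
    fix g
    let ?c = "orbit_mean h x"
    have "rot_avg a (rot_avgs w h) (g *v x) - ?c
      = (\<Sum>i\<in>level_set n r a. p i / weight a * (rot_avgs w h ((matrix_inv (Q i) ** g) *v x) - ?c))"
      using coeff_sum[OF a]
      by (simp add: rot_avg_def matrix_vector_mul_assoc right_diff_distrib sum_subtractf
          sum_distrib_right[symmetric] del: times_divide_eq_left)
    then show "?F (a # w) g = markov_op n r p Q a (?F w) g"
      unfolding markov_op_def rot_avgs_simps of_real_mult[symmetric] of_real_sum[symmetric] by simp
  qed
  moreover have "L2_norm \<mu> (markov_op n r p Q a (?F w)) \<le> gap a * (\<Prod>a\<leftarrow>w. gap a)"
    using markov_op_contraction[OF a IH(1)] mult_left_mono[OF IH(2) gap_nonneg[OF a]] by linarith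
  ultimately show ?case
    using markov_op_L2(1)[OF a IH(1)] by simp
qed

end

section \<open>The self-similar measure and its Fourier transform\<close>

locale self_similar = rotation_walk \<mu> n r p Q
  for \<mu> :: "(real^'d^'d) measure" and n r p Q +
  fixes t :: "nat \<Rightarrow> real^'d" and f :: "nat \<Rightarrow> real^'d \<Rightarrow> real^'d" and \<nu> :: "(real^'d) measure"
  assumes r_bound: "i \<in> {1..n} \<Longrightarrow> 0 < \<bar>r i\<bar> \<and> \<bar>r i\<bar> < 1"
    and f_eq: "i \<in> {1..n} \<Longrightarrow> f i x = r i *\<^sub>R (Q i *v x) + t i"
    and p_sum: "(\<Sum>i=1..n. p i) = 1"
    and ssm: "self_similar_measure n p f \<nu>"
begin

lemma sets_nu [measurable_cong]: "sets \<nu> = sets borel" and prob_nu: "prob_space \<nu>"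
  and nu_eq: "A \<in> sets borel \<Longrightarrow> measure \<nu> A = (\<Sum>i=1..n. p i * measure (distr \<nu> borel (f i)) A)"
  using ssm by (auto simp: self_similar_measure_def)

interpretation nu: prob_space \<nu> by (rule prob_nu)

lemma space_nu: "space \<nu> = UNIV"
  using sets_eq_imp_space_eq[OF sets_nu] by simp

lemma measurable_f:
  assumes "i \<in> {1..n}"
  shows "f i \<in> borel \<rightarrow>\<^sub>M borel"
proof -
  note [measurable] = measurable_mult_vec[of "Q i"]
  have "f i = (\<lambda>x. r i *\<^sub>R (Q i *v x) + t i)" using f_eq[OF assms] by blast
  then show ?thesis by simp
qed

lemma index_nonempty: "{1..n} \<noteq> {}"
  using p_sum by force

lemma nn_integral_nu:
  assumes "h \<in> borel_measurable borel"
  shows "(\<integral>\<^sup>+x. h x \<partial>\<nu>) = (\<Sum>i=1..n. ennreal (p i) * (\<integral>\<^sup>+x. h (f i x) \<partial>\<nu>))"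
  using assms
proof (induction rule: borel_measurable_induct)
  case (cong h g)
  then show ?case by (simp cong: nn_integral_cong)
next
  case (set A)
  have "emeasure \<nu> A = ennreal (\<Sum>i=1..n. p i * measure (distr \<nu> borel (f i)) A)"
    using set by (simp add: nu.emeasure_eq_measure nu_eq)
  also have "\<dots> = (\<Sum>i=1..n. ennreal (p i) * emeasure \<nu> (f i -` A))"
  proof (subst sum_ennreal[symmetric])
    fix i assume "i \<in> {1..n}"
    then show "0 \<le> p i * measure (distr \<nu> borel (f i)) A"
      using p_pos[of i] by simp
  next
    show "(\<Sum>i=1..n. ennreal (p i * measure (distr \<nu> borel (f i)) A))
        = (\<Sum>i=1..n. ennreal (p i) * emeasure \<nu> (f i -` A))"
    proof (intro sum.cong refl)
      fix i assume i: "i \<in> {1..n}"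
      then have "f i \<in> \<nu> \<rightarrow>\<^sub>M borel" using measurable_f by measurable
      then have "measure (distr \<nu> borel (f i)) A = measure \<nu> (f i -` A)"
        using set by (simp add: measure_distr space_nu)
      then show "ennreal (p i * measure (distr \<nu> borel (f i)) A) = ennreal (p i) * emeasure \<nu> (f i -` A)"
        using p_pos[OF i] by (simp add: ennreal_mult nu.emeasure_eq_measure)
    qed
  qed
  also have "\<dots> = (\<Sum>i=1..n. ennreal (p i) * (\<integral>\<^sup>+x. indicator A (f i x) \<partial>\<nu>))"
  proof (intro sum.cong refl)
    fix i assume i: "i \<in> {1..n}"
    have "f i -` A \<in> sets \<nu>" using measurable_sets[OF measurable_f[OF i] set] sets_nu by simp
    then have "emeasure \<nu> (f i -` A) = (\<integral>\<^sup>+x. indicator (f i -` A) x \<partial>\<nu>)" by simp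
    also have "\<dots> = (\<integral>\<^sup>+x. indicator A (f i x) \<partial>\<nu>)"
      by (intro nn_integral_cong) (simp add: indicator_def)
    finally show "ennreal (p i) * emeasure \<nu> (f i -` A) = ennreal (p i) * (\<integral>\<^sup>+x. indicator A (f i x) \<partial>\<nu>)"
      by simp
  qed
  finally show ?case using set sets_nu by simp
next
  case (mult u c)
  have "(\<integral>\<^sup>+x. c * u (f i x) \<partial>\<nu>) = c * (\<integral>\<^sup>+x. u (f i x) \<partial>\<nu>)" if "i \<in> {1..n}" for i
    using measurable_compose[OF measurable_f[OF that] mult.hyps(2)] sets_nu
    by (intro nn_integral_cmult) (simp cong: measurable_cong_sets)
  then show ?case
    using mult by (simp add: nn_integral_cmult sum_distrib_left mult_ac cong: measurable_cong_sets[OF sets_nu refl])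
next
  case (add u v)
  have "(\<integral>\<^sup>+x. v (f i x) + u (f i x) \<partial>\<nu>) = (\<integral>\<^sup>+x. v (f i x) \<partial>\<nu>) + (\<integral>\<^sup>+x. u (f i x) \<partial>\<nu>)" if "i \<in> {1..n}" for i
    using measurable_compose[OF measurable_f[OF that] add.hyps(1)]
      measurable_compose[OF measurable_f[OF that] add.hyps(3)] sets_nu
    by (intro nn_integral_add) (simp_all cong: measurable_cong_sets)
  moreover have "(\<integral>\<^sup>+x. v x + u x \<partial>\<nu>) = (\<integral>\<^sup>+x. v x \<partial>\<nu>) + (\<integral>\<^sup>+x. u x \<partial>\<nu>)"
    using add.hyps(1,3) sets_nu by (intro nn_integral_add) (simp_all cong: measurable_cong_sets)
  ultimately show ?case
    using add by (simp add: distrib_left sum.distrib)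
next
  case (seq U)
  have 1: "(\<integral>\<^sup>+x. (SUP k. U k x) \<partial>\<nu>) = (SUP k. \<integral>\<^sup>+x. U k x \<partial>\<nu>)"
    using seq.hyps(1) sets_nu
    by (intro nn_integral_monotone_convergence_SUP \<open>incseq U\<close>) (simp cong: measurable_cong_sets)
  have 2: "(\<integral>\<^sup>+x. (SUP k. U k (f i x)) \<partial>\<nu>) = (SUP k. \<integral>\<^sup>+x. U k (f i x) \<partial>\<nu>)" if "i \<in> {1..n}" for i
  proof (rule nn_integral_monotone_convergence_SUP)
    show "incseq (\<lambda>k x. U k (f i x))"
      using \<open>incseq U\<close> by (auto simp: incseq_def le_fun_def)
    show "(\<lambda>x. U k (f i x)) \<in> borel_measurable \<nu>" for k
      using measurable_compose[OF measurable_f[OF that] seq.hyps(1)] sets_nu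
      by (simp cong: measurable_cong_sets)
  qed
  have inc: "incseq (\<lambda>k. \<integral>\<^sup>+x. U k (f i x) \<partial>\<nu>)" for i
    using \<open>incseq U\<close> by (auto simp: incseq_def le_fun_def intro!: nn_integral_mono)
  have "(SUP k. \<Sum>i=1..n. ennreal (p i) * (\<integral>\<^sup>+x. U k (f i x) \<partial>\<nu>))
      = (\<Sum>i=1..n. SUP k. ennreal (p i) * (\<integral>\<^sup>+x. U k (f i x) \<partial>\<nu>))"
    using inc by (intro ennreal_SUP_sum) (auto simp: incseq_def intro!: mult_left_mono)
  also have "\<dots> = (\<Sum>i=1..n. ennreal (p i) * (SUP k. \<integral>\<^sup>+x. U k (f i x) \<partial>\<nu>))"
    by (simp add: SUP_mult_left_ennreal)
  finally show ?case
    using 1 2 seq.IH by (simp add: image_comp)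
qed

lemma integral_nu_real:
  fixes h :: "real^'d \<Rightarrow> real"
  assumes h [measurable]: "h \<in> borel_measurable borel" and b: "\<And>x. \<bar>h x\<bar> \<le> 1"
  shows "(LINT x|\<nu>. h x) = (\<Sum>i=1..n. p i * (LINT x|\<nu>. h (f i x)))"
proof -
  have [measurable]: "(\<lambda>x. h (f i x)) \<in> borel_measurable \<nu>" if "i \<in> {1..n}" for i
    using measurable_compose[OF measurable_f[OF that] h] sets_nu by (simp cong: measurable_cong_sets)
  have hn [measurable]: "h \<in> borel_measurable \<nu>"
    using h sets_nu by (simp cong: measurable_cong_sets)
  have pos: "0 \<le> 1 + h x" for x using b[of x] by linarith
  have i1: "integrable \<nu> h"
    using b by (intro nu.integrable_const_bound[where B=1]) auto
  have i2: "integrable \<nu> (\<lambda>x. h (f i x))" if "i \<in> {1..n}" for i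
    using b that by (intro nu.integrable_const_bound[where B=1]) auto
  have "ennreal (1 + (LINT x|\<nu>. h x)) = (\<integral>\<^sup>+x. ennreal (1 + h x) \<partial>\<nu>)"
    using i1 pos by (subst nn_integral_eq_integral) (auto simp: nu.prob_space)
  also have "\<dots> = (\<Sum>i=1..n. ennreal (p i) * (\<integral>\<^sup>+x. ennreal (1 + h (f i x)) \<partial>\<nu>))"
    by (rule nn_integral_nu) measurable
  also have "\<dots> = (\<Sum>i=1..n. ennreal (p i * (1 + (LINT x|\<nu>. h (f i x)))))"
  proof (intro sum.cong refl)
    fix i assume i: "i \<in> {1..n}"
    have "(\<integral>\<^sup>+x. ennreal (1 + h (f i x)) \<partial>\<nu>) = ennreal (1 + (LINT x|\<nu>. h (f i x)))"
      using i2[OF i] pos by (subst nn_integral_eq_integral) (auto simp: nu.prob_space)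
    then show "ennreal (p i) * (\<integral>\<^sup>+x. ennreal (1 + h (f i x)) \<partial>\<nu>)
        = ennreal (p i * (1 + (LINT x|\<nu>. h (f i x))))"
      using p_pos[OF i] by (simp add: ennreal_mult')
  qed
  also have "\<dots> = ennreal (\<Sum>i=1..n. p i * (1 + (LINT x|\<nu>. h (f i x))))"
  proof (rule sum_ennreal)
    fix i assume i: "i \<in> {1..n}"
    have "0 \<le> (LINT x|\<nu>. 1 + h (f i x))" using pos by (intro integral_nonneg_AE) auto
    also have "\<dots> = 1 + (LINT x|\<nu>. h (f i x))" using i2[OF i] by (simp add: nu.prob_space)
    finally show "0 \<le> p i * (1 + (LINT x|\<nu>. h (f i x)))" using p_pos[OF i] by simp
  qed
  finally have *: "ennreal (1 + (LINT x|\<nu>. h x)) = ennreal (\<Sum>i=1..n. p i * (1 + (LINT x|\<nu>. h (f i x))))" .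
  have "0 \<le> (LINT x|\<nu>. 1 + h x)" using pos by (intro integral_nonneg_AE) auto
  then have 1: "0 \<le> 1 + (LINT x|\<nu>. h x)" using i1 by (simp add: nu.prob_space)
  have 2: "0 \<le> (\<Sum>i=1..n. p i * (1 + (LINT x|\<nu>. h (f i x))))"
  proof (rule sum_nonneg)
    fix i assume i: "i \<in> {1..n}"
    have "0 \<le> (LINT x|\<nu>. 1 + h (f i x))" using pos by (intro integral_nonneg_AE) auto
    also have "\<dots> = 1 + (LINT x|\<nu>. h (f i x))" using i2[OF i] by (simp add: nu.prob_space)
    finally show "0 \<le> p i * (1 + (LINT x|\<nu>. h (f i x)))" using p_pos[OF i] by simp
  qed
  have "1 + (LINT x|\<nu>. h x) = (\<Sum>i=1..n. p i * (1 + (LINT x|\<nu>. h (f i x))))"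
    using * 1 2 by simp
  also have "\<dots> = 1 + (\<Sum>i=1..n. p i * (LINT x|\<nu>. h (f i x)))"
    using p_sum by (simp only: distrib_left sum.distrib mult_1_right)
  finally show ?thesis by simp
qed

lemma integral_nu_complex:
  fixes h :: "real^'d \<Rightarrow> complex"
  assumes h [measurable]: "h \<in> borel_measurable borel" and b: "\<And>x. cmod (h x) \<le> 1"
  shows "(LINT x|\<nu>. h x) = (\<Sum>i=1..n. of_real (p i) * (LINT x|\<nu>. h (f i x)))"
proof -
  have [measurable]: "(\<lambda>x. h (f i x)) \<in> borel_measurable \<nu>" if "i \<in> {1..n}" for i
    using measurable_compose[OF measurable_f[OF that] h] sets_nu by (simp cong: measurable_cong_sets)
  have [measurable]: "h \<in> borel_measurable \<nu>"
    using h sets_nu by (simp cong: measurable_cong_sets)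
  have i1: "integrable \<nu> h"
    using b by (intro nu.integrable_const_bound[where B=1]) auto
  have i2: "integrable \<nu> (\<lambda>x. h (f i x))" if "i \<in> {1..n}" for i
    using b that by (intro nu.integrable_const_bound[where B=1]) auto
  have "\<bar>Re (h x)\<bar> \<le> 1" "\<bar>Im (h x)\<bar> \<le> 1" for x
    using b[of x] abs_Re_le_cmod[of "h x"] abs_Im_le_cmod[of "h x"] by linarith+
  then have R: "(LINT x|\<nu>. Re (h x)) = (\<Sum>i=1..n. p i * (LINT x|\<nu>. Re (h (f i x))))"
    and I: "(LINT x|\<nu>. Im (h x)) = (\<Sum>i=1..n. p i * (LINT x|\<nu>. Im (h (f i x))))"
    by (intro integral_nu_real; simp)+
  have "Re (LINT x|\<nu>. h x) = Re (\<Sum>i=1..n. of_real (p i) * (LINT x|\<nu>. h (f i x)))"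
    using R i1 i2 by simp
  moreover have "Im (LINT x|\<nu>. h x) = Im (\<Sum>i=1..n. of_real (p i) * (LINT x|\<nu>. h (f i x)))"
    using I i1 i2 by simp
  ultimately show ?thesis by (rule complex_eqI)
qed

definition wave :: "real^'d \<Rightarrow> real^'d \<Rightarrow> complex" where
  "wave \<xi> x = exp (- 2 * of_real pi * \<i> * of_real (x \<bullet> \<xi>))"

lemma wave_iexp: "wave \<xi> x = iexp (- 2 * pi * (x \<bullet> \<xi>))"
  by (simp add: wave_def mult_ac)

lemma norm_wave [simp]: "cmod (wave \<xi> x) = 1"
  unfolding wave_iexp by simp

lemma wave_add: "wave (\<xi> + \<eta>) x = wave \<xi> x * wave \<eta> x"
  by (simp add: wave_def exp_add[symmetric] inner_add_right algebra_simps)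

lemma wave_scale: "wave (of_nat k *\<^sub>R \<xi>) x = wave \<xi> x ^ k"
  by (simp add: wave_def exp_of_nat_mult[symmetric] algebra_simps)

lemma measurable_wave [measurable]: "wave \<xi> \<in> borel_measurable borel"
  unfolding wave_def[abs_def] by measurable

lemma measurable_wave_nu [measurable]: "wave \<xi> \<in> borel_measurable \<nu>"
  using measurable_wave sets_nu by (simp cong: measurable_cong_sets)

lemma integrable_wave [simp]: "integrable \<nu> (wave \<xi>)"
  by (intro nu.integrable_const_bound[where B=1]) auto

lemma fourier_wave: "fourier_measure \<nu> \<xi> = (LINT x|\<nu>. wave \<xi> x)"
  by (simp add: fourier_measure_def wave_def)

lemma fourier_le_1: "cmod (fourier_measure \<nu> \<xi>) \<le> 1"
proof -
  have "cmod (fourier_measure \<nu> \<xi>) \<le> (LINT x|\<nu>. cmod (wave \<xi> x))"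
    unfolding fourier_wave by (rule integral_norm_bound)
  then show ?thesis by (simp add: nu.prob_space)
qed

lemma fourier_minus: "cmod (fourier_measure \<nu> (- \<xi>)) = cmod (fourier_measure \<nu> \<xi>)"
proof -
  have "wave (- \<xi>) x = cnj (wave \<xi> x)" for x
    by (simp add: wave_def exp_cnj)
  then have "fourier_measure \<nu> (- \<xi>) = cnj (fourier_measure \<nu> \<xi>)"
    by (simp add: fourier_wave)
  then show ?thesis by simp
qed

definition \<phi> :: "real^'d \<Rightarrow> real" where
  "\<phi> \<xi> = (cmod (fourier_measure \<nu> \<xi>))\<^sup>2"

lemma phi_nonneg: "0 \<le> \<phi> \<xi>" and phi_le_1: "\<phi> \<xi> \<le> 1"
  using fourier_le_1[of \<xi>] by (auto simp: \<phi>_def abs_square_le_1)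

lemma measurable_phi [measurable]: "\<phi> \<in> borel_measurable borel"
proof -
  have "(\<lambda>z. wave (fst z) (snd z)) \<in> borel_measurable (borel \<Otimes>\<^sub>M \<nu>)"
  proof -
    have "(\<lambda>z. wave (fst z) (snd z)) \<in> borel_measurable (borel \<Otimes>\<^sub>M borel)"
      unfolding wave_def by measurable
    then show ?thesis
      using sets_pair_measure_cong[OF refl sets_nu] by (simp cong: measurable_cong_sets)
  qed
  then have "fourier_measure \<nu> \<in> borel_measurable borel"
    unfolding fourier_wave[abs_def]
    by (intro nu.borel_measurable_lebesgue_integral) (simp add: case_prod_beta)
  then show ?thesis unfolding \<phi>_def[abs_def] by measurable
qed

lemma fourier_self_similar:
  "fourier_measure \<nu> \<xi> = (\<Sum>i=1..n. of_real (p i) *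
     (wave \<xi> (t i) * fourier_measure \<nu> (r i *\<^sub>R (matrix_inv (Q i) *v \<xi>))))"
proof -
  have "fourier_measure \<nu> \<xi> = (\<Sum>i=1..n. of_real (p i) * (LINT x|\<nu>. wave \<xi> (f i x)))"
    unfolding fourier_wave by (rule integral_nu_complex) auto
  also have "\<dots> = (\<Sum>i=1..n. of_real (p i) *
     (wave \<xi> (t i) * fourier_measure \<nu> (r i *\<^sub>R (matrix_inv (Q i) *v \<xi>))))"
  proof (intro sum.cong refl arg_cong2[where f="(*)"])
    fix i assume i: "i \<in> {1..n}"
    have "wave \<xi> (f i x) = wave \<xi> (t i) * wave (r i *\<^sub>R (matrix_inv (Q i) *v \<xi>)) x" for x
      by (simp add: wave_def f_eq[OF i] inner_add_left SO_inner[OF Q_SO[OF i]] exp_add[symmetric]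
          algebra_simps)
    then show "(LINT x|\<nu>. wave \<xi> (f i x))
        = wave \<xi> (t i) * fourier_measure \<nu> (r i *\<^sub>R (matrix_inv (Q i) *v \<xi>))"
      by (simp add: fourier_wave)
  qed
  finally show ?thesis .
qed

text \<open>Jensen's inequality for the self-similarity relation; as \<open>\<phi>\<close> is even, only \<open>\<bar>r i\<bar>\<close> matters,
  so the maps with a common contraction ratio combine to one rotation average.\<close>

lemma phi_subaverage:
  "\<phi> \<xi> \<le> (\<Sum>a\<in>levels. weight a * rot_avg a \<phi> (a *\<^sub>R \<xi>))"
proof -
  let ?y = "\<lambda>i. r i *\<^sub>R (matrix_inv (Q i) *v \<xi>)"
  have "cmod (fourier_measure \<nu> \<xi>) \<le> (\<Sum>i=1..n. cmod (of_real (p i) * (wave \<xi> (t i) * fourier_measure \<nu> (?y i))))"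
    by (subst fourier_self_similar) (rule norm_sum)
  also have "\<dots> = (\<Sum>i=1..n. p i * cmod (fourier_measure \<nu> (?y i)))"
    using p_pos by (intro sum.cong) (auto simp: norm_mult less_imp_le)
  finally have "\<phi> \<xi> \<le> (\<Sum>i=1..n. p i * cmod (fourier_measure \<nu> (?y i)))\<^sup>2"
    unfolding \<phi>_def by (intro power_mono) auto
  also have "\<dots> \<le> (\<Sum>i=1..n. p i * \<phi> (?y i))"
    unfolding \<phi>_def by (intro weighted_mean_square p_sum less_imp_le p_pos)
  also have "\<dots> = (\<Sum>i=1..n. p i * \<phi> (matrix_inv (Q i) *v (\<bar>r i\<bar> *\<^sub>R \<xi>)))"
  proof (intro sum.cong refl arg_cong2[where f="(*)"])
    fix i
    show "\<phi> (?y i) = \<phi> (matrix_inv (Q i) *v (\<bar>r i\<bar> *\<^sub>R \<xi>))"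
    proof (cases "0 \<le> r i")
      case False
      then have "\<bar>r i\<bar> = - r i" by simp
      then have "matrix_inv (Q i) *v (\<bar>r i\<bar> *\<^sub>R \<xi>) = - ?y i"
        by (metis matrix_vector_mult_scaleR scaleR_minus_left)
      then show ?thesis by (simp only: \<phi>_def fourier_minus)
    qed (simp add: matrix_vector_mult_scaleR)
  qed
  also have "\<dots> = (\<Sum>a\<in>levels. \<Sum>i\<in>{i\<in>{1..n}. \<bar>r i\<bar> = a}. p i * \<phi> (matrix_inv (Q i) *v (\<bar>r i\<bar> *\<^sub>R \<xi>)))"
    by (rule sum.image_gen) simp
  also have "\<dots> = (\<Sum>a\<in>levels. weight a * rot_avg a \<phi> (a *\<^sub>R \<xi>))"
  proof (intro sum.cong refl)
    fix a assume "a \<in> levels"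
    then have "weight a \<noteq> 0" using weight_pos by force
    then show "(\<Sum>i\<in>{i\<in>{1..n}. \<bar>r i\<bar> = a}. p i * \<phi> (matrix_inv (Q i) *v (\<bar>r i\<bar> *\<^sub>R \<xi>)))
        = weight a * rot_avg a \<phi> (a *\<^sub>R \<xi>)"
      by (simp add: rot_avg_def level_set_def[symmetric] sum_distrib_left)
         (intro sum.cong, auto simp: level_set_def)
  qed
  finally show ?thesis .
qed

lemma sum_weight: "(\<Sum>a\<in>levels. weight a) = 1"
proof -
  have "(\<Sum>i=1..n. p i) = (\<Sum>a\<in>levels. \<Sum>i\<in>{i\<in>{1..n}. \<bar>r i\<bar> = a}. p i)"
    by (rule sum.image_gen) simp
  then show ?thesis using p_sum by (simp add: level_weight_def level_set_def)
qed

text \<open>All maps contract towards a common ball, of radius \<open>K\<close> in the proof.  With \<open>\<rho>\<close> the largest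
  contraction ratio, the tail function \<open>u \<mapsto> \<nu> {norm x > K + u}\<close> is dominated by its own values at
  \<open>u / \<rho>\<close>, \<open>u / \<rho>\<^sup>2\<close>, ..., hence vanishes for \<open>u > 0\<close>.\<close>

lemma bounded_support:
  obtains K where "K > 0" "AE x in \<nu>. norm x \<le> K"
proof -
  define \<rho> where "\<rho> = Max levels"
  define \<tau> where "\<tau> = (\<Sum>i=1..n. norm (t i))"
  define K where "K = \<tau> / (1 - \<rho>)"
  define G where "G s = measure \<nu> {x. norm x > s}" for s
  have \<rho>: "\<rho> \<in> levels" unfolding \<rho>_def using index_nonempty by (intro Max_in) auto
  then have \<rho>01: "0 < \<rho>" "\<rho> < 1" using r_bound by auto
  have \<rho>_ge: "\<bar>r i\<bar> \<le> \<rho>" if "i \<in> {1..n}" for i unfolding \<rho>_def using that by (intro Max_ge) auto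
  have \<tau>_ge: "norm (t i) \<le> \<tau>" if "i \<in> {1..n}" for i
    unfolding \<tau>_def using that by (intro member_le_sum) auto
  have "\<tau> \<ge> 0" unfolding \<tau>_def by (intro sum_nonneg) auto
  then have K0: "K \<ge> 0" using \<rho>01 by (simp add: K_def)
  have "K * (1 - \<rho>) = \<tau>" using \<rho>01 by (simp add: K_def)
  then have \<tau>K: "\<tau> = K - \<rho> * K" by (simp add: algebra_simps)
  have S: "{x::real^'d. norm x > s} \<in> sets borel" for s by measurable
  have step: "G (K + u) \<le> G (K + u / \<rho>)" for u
  proof -
    have "G (K + u) = (\<Sum>i=1..n. p i * measure (distr \<nu> borel (f i)) {x. norm x > K + u})"
      unfolding G_def by (intro nu_eq S)
    also have "\<dots> \<le> (\<Sum>i=1..n. p i * G (K + u / \<rho>))"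
    proof (intro sum_mono mult_left_mono)
      fix i assume i: "i \<in> {1..n}"
      then have "f i \<in> \<nu> \<rightarrow>\<^sub>M borel" using measurable_f by measurable
      then have "measure (distr \<nu> borel (f i)) {x. norm x > K + u} = measure \<nu> (f i -` {x. norm x > K + u})"
        using S by (simp add: measure_distr space_nu)
      also have "\<dots> \<le> G (K + u / \<rho>)"
        unfolding G_def
      proof (intro nu.finite_measure_mono)
        show "f i -` {x. norm x > K + u} \<subseteq> {x. norm x > K + u / \<rho>}"
        proof safe
          fix x assume "K + u < norm (f i x)"
          also have "norm (f i x) \<le> \<bar>r i\<bar> * norm x + norm (t i)"
            unfolding f_eq[OF i]
            by (rule order_trans[OF norm_triangle_ineq]) (simp add: SO_norm[OF Q_SO[OF i]])
          also have "\<dots> \<le> \<rho> * norm x + (K - \<rho> * K)"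
            using \<rho>_ge[OF i] \<tau>_ge[OF i] \<tau>K by (intro add_mono mult_right_mono) auto
          finally have "u < \<rho> * (norm x - K)" by (simp add: algebra_simps)
          then show "K + u / \<rho> < norm x" using \<rho>01 by (simp add: field_simps)
        qed
        show "{x. norm x > K + u / \<rho>} \<in> sets \<nu>" using S sets_nu by simp
      qed
      finally show "measure (distr \<nu> borel (f i)) {x. norm x > K + u} \<le> G (K + u / \<rho>)" .
      show "0 \<le> p i" using p_pos[OF i] by simp
    qed
    also have "\<dots> = G (K + u / \<rho>)" using p_sum by (simp add: sum_distrib_right[symmetric])
    finally show ?thesis .
  qed
  have iter: "G (K + 1) \<le> G (K + (1 / \<rho>) ^ k)" for k
  proof (induction k)
    case (Suc k)
    then show ?case using step[of "(1 / \<rho>) ^ k"] by simp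
  qed simp
  let ?S = "\<lambda>k. {x::real^'d. norm x > K + (1 / \<rho>) ^ k}"
  have "(\<lambda>k. measure \<nu> (?S k)) \<longlonglongrightarrow> measure \<nu> (\<Inter>k. ?S k)"
  proof (rule nu.finite_Lim_measure_decseq)
    show "range ?S \<subseteq> sets \<nu>" unfolding sets_nu using S by (intro image_subsetI)
    have "(1 / \<rho>) ^ k \<le> (1 / \<rho>) ^ l" if "k \<le> l" for k l
      using that \<rho>01 by (intro power_increasing) auto
    then show "decseq ?S"
      unfolding decseq_def by (intro allI impI Collect_mono) (meson add_left_mono order_le_less_trans)
  qed
  moreover have "(\<Inter>k. ?S k) = {}"
  proof -
    have "\<exists>k. \<not> norm x > K + (1 / \<rho>) ^ k" for x :: "real^'d"
    proof -
      have "1 < 1 / \<rho>" using \<rho>01 by simp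
      then obtain k where "norm x < (1 / \<rho>) ^ k" using real_arch_pow by blast
      then show ?thesis using K0 by (intro exI[of _ k]) linarith
    qed
    then show ?thesis by auto
  qed
  ultimately have "(\<lambda>k. G (K + (1 / \<rho>) ^ k)) \<longlonglongrightarrow> 0" by (simp add: G_def)
  then have "G (K + 1) \<le> 0"
    by (rule LIMSEQ_le_const) (use iter in blast)
  then have "measure \<nu> {x. norm x > K + 1} = 0"
    unfolding G_def by (simp add: measure_le_0_iff)
  then have "emeasure \<nu> {x. norm x > K + 1} = 0" by (simp add: nu.emeasure_eq_measure)
  then have "AE x in \<nu>. norm x \<le> K + 1"
    using S[of "K + 1"] sets_nu by (intro AE_I[where N="{x. norm x > K + 1}"]) auto
  then show ?thesis using K0 by (intro that[of "K + 1"]) auto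
qed

text \<open>The \<open>m\<close>-th difference of the Fourier transform with step \<open>h\<close> is the transform of
  \<open>(1 - wave h)\<^sup>m d\<nu>\<close>, which is of order \<open>(norm h)\<^sup>m\<close> because \<open>\<nu>\<close> has bounded support.  Solving for the
  value at \<open>\<xi>\<close> recovers it from the values at the other nodes; this takes the place of a
  reproducing kernel for band-limited functions.\<close>

lemma fourier_difference:
  assumes K: "AE x in \<nu>. norm x \<le> K" "K > 0"
  shows "cmod (fourier_measure \<nu> \<xi>) \<le>
    (\<Sum>k=1..m. of_nat (m choose k) * cmod (fourier_measure \<nu> (\<xi> + of_nat k *\<^sub>R h))) + (2 * pi * K * norm h) ^ m"
proof -
  let ?c = "\<lambda>k. (of_nat (m choose k) * (-1) ^ k :: complex)"
  let ?F = "\<lambda>k. fourier_measure \<nu> (\<xi> + of_nat k *\<^sub>R h)"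
  have expand: "wave \<xi> x * (1 - wave h x) ^ m = (\<Sum>k\<le>m. ?c k * wave (\<xi> + of_nat k *\<^sub>R h) x)" for x
  proof -
    have "(1 - wave h x) ^ m = (- wave h x + 1) ^ m" by simp
    also have "\<dots> = (\<Sum>k\<le>m. of_nat (m choose k) * (- wave h x) ^ k * 1 ^ (m - k))"
      by (rule binomial_ring)
    finally show ?thesis
      unfolding wave_add wave_scale
      by (simp add: sum_distrib_left power_minus[of "wave h x"] mult_ac)
  qed
  have "(LINT x|\<nu>. wave \<xi> x * (1 - wave h x) ^ m) = (\<Sum>k\<le>m. ?c k * ?F k)"
    unfolding expand fourier_wave
    by (subst Bochner_Integration.integral_sum) (auto intro!: integrable_mult_right)
  also have "\<dots> = fourier_measure \<nu> \<xi> + (\<Sum>k=1..m. ?c k * ?F k)"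
    by (simp add: atMost_atLeast0 sum.atLeast_Suc_atMost)
  finally have eq: "fourier_measure \<nu> \<xi> = (LINT x|\<nu>. wave \<xi> x * (1 - wave h x) ^ m) - (\<Sum>k=1..m. ?c k * ?F k)"
    by simp
  have int: "integrable \<nu> (\<lambda>x. wave \<xi> x * (1 - wave h x) ^ m)"
    unfolding expand by (auto intro!: integrable_mult_right)
  have "cmod (LINT x|\<nu>. wave \<xi> x * (1 - wave h x) ^ m)
      \<le> (LINT x|\<nu>. cmod (wave \<xi> x * (1 - wave h x) ^ m))"
    by (rule integral_norm_bound)
  also have "\<dots> \<le> (LINT x|\<nu>. (2 * pi * K * norm h) ^ m)"
  proof (rule integral_mono_AE)
    show "AE x in \<nu>. cmod (wave \<xi> x * (1 - wave h x) ^ m) \<le> (2 * pi * K * norm h) ^ m"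
      using K(1)
    proof eventually_elim
      case (elim x)
      have "cmod (1 - wave h x) = cmod (wave h x - 1)" by (rule norm_minus_commute)
      also have "\<dots> \<le> \<bar>- 2 * pi * (x \<bullet> h)\<bar>"
        using iexp_approx1[of "- 2 * pi * (x \<bullet> h)" 0] by (simp add: wave_iexp)
      also have "\<dots> = 2 * pi * \<bar>x \<bullet> h\<bar>" by (simp add: abs_mult)
      also have "\<bar>x \<bullet> h\<bar> \<le> norm x * norm h" by (rule Cauchy_Schwarz_ineq2)
      also have "\<dots> \<le> K * norm h" using elim by (intro mult_right_mono) auto
      finally have "cmod (1 - wave h x) \<le> 2 * pi * K * norm h" by simp
      then show ?case by (auto simp: norm_mult norm_power intro: power_mono)
    qed
  qed (use int in auto)
  finally have "cmod (LINT x|\<nu>. wave \<xi> x * (1 - wave h x) ^ m) \<le> (LINT x|\<nu>. (2 * pi * K * norm h) ^ m)" .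
  then have "cmod (LINT x|\<nu>. wave \<xi> x * (1 - wave h x) ^ m) \<le> (2 * pi * K * norm h) ^ m"
    by (simp add: nu.prob_space)
  moreover have "cmod (\<Sum>k=1..m. ?c k * ?F k) \<le> (\<Sum>k=1..m. of_nat (m choose k) * cmod (?F k))"
    by (rule order_trans[OF norm_sum]) (simp add: norm_mult norm_power)
  ultimately show ?thesis
    unfolding eq using norm_triangle_ineq4[of "LINT x|\<nu>. wave \<xi> x * (1 - wave h x) ^ m" "\<Sum>k=1..m. ?c k * ?F k"]
    by linarith
qed

end

section \<open>A pointwise bound at one scale\<close>

lemma sum_square_le:
  fixes y :: "'i \<Rightarrow> real"
  shows "(\<Sum>i\<in>I. y i)\<^sup>2 \<le> real (card I) * (\<Sum>i\<in>I. (y i)\<^sup>2)"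
  using Cauchy_Schwarz_ineq_sum[of "\<lambda>_. 1" y I] by simp

lemma power_diff_le:
  fixes x y :: real
  assumes "0 \<le> y" "y \<le> x"
  shows "x ^ d - y ^ d \<le> real d * x ^ (d - 1) * (x - y)"
proof (induction d)
  case (Suc d)
  have "x ^ Suc d - y ^ Suc d = x * (x ^ d - y ^ d) + y ^ d * (x - y)"
    by (simp add: algebra_simps)
  also have "\<dots> \<le> x * (real d * x ^ (d - 1) * (x - y)) + x ^ d * (x - y)"
    using assms Suc by (intro add_mono mult_left_mono mult_right_mono power_mono) auto
  also have "\<dots> = real (Suc d) * x ^ (Suc d - 1) * (x - y)"
    by (cases d) (auto simp: algebra_simps)
  finally show ?case .
qed simp

lemma nn_integral_lborel_dilate_le:
  fixes h :: "'a::euclidean_space \<Rightarrow> ennreal"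
  assumes [measurable]: "h \<in> borel_measurable borel" and "c \<ge> 1"
  shows "(\<integral>\<^sup>+x. h (y + c *\<^sub>R x) \<partial>lborel) \<le> (\<integral>\<^sup>+x. h x \<partial>lborel)"
proof -
  have "(\<integral>\<^sup>+x. h (y + c *\<^sub>R x) \<partial>lborel) \<le> (\<integral>\<^sup>+x. ennreal (\<bar>c\<bar> ^ DIM('a)) * h (y + c *\<^sub>R x) \<partial>lborel)"
  proof (rule nn_integral_mono)
    fix x
    have "1 \<le> ennreal (\<bar>c\<bar> ^ DIM('a))"
      using assms(2) by (simp add: one_le_power)
    then show "h (y + c *\<^sub>R x) \<le> ennreal (\<bar>c\<bar> ^ DIM('a)) * h (y + c *\<^sub>R x)"
      using mult_right_mono[of 1 "ennreal (\<bar>c\<bar> ^ DIM('a))" "h (y + c *\<^sub>R x)"] by simp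
  qed
  also have "\<dots> = (\<integral>\<^sup>+x. h x \<partial>density (distr lborel borel (\<lambda>x. y + c *\<^sub>R x)) (\<lambda>_. \<bar>c\<bar> ^ DIM('a)))"
    by (simp add: nn_integral_density nn_integral_distr)
  also have "\<dots> = (\<integral>\<^sup>+x. h x \<partial>lborel)"
    using lborel_affine[of c y] assms(2) by simp
  finally show ?thesis .
qed

lemma emeasure_annulus_le:
  assumes "0 \<le> u" "u \<le> s"
  shows "emeasure lborel {x::real^'d. s - u \<le> norm x \<and> norm x \<le> s + u}
    \<le> ennreal (unit_ball_vol (real CARD('d)) * (real CARD('d) * (s + u) ^ (CARD('d) - 1) * (2 * u)))"
proof -
  let ?V = "unit_ball_vol (real CARD('d))"
  have "{x::real^'d. s - u \<le> norm x \<and> norm x \<le> s + u} = cball 0 (s + u) - ball 0 (s - u)"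
    by auto
  also have "emeasure lborel \<dots> = emeasure lborel (cball (0::real^'d) (s + u)) - emeasure lborel (ball (0::real^'d) (s - u))"
    using assms emeasure_lborel_ball_finite[of "0::real^'d" "s - u"]
    by (intro emeasure_Diff) auto
  also have "\<dots> = ennreal (?V * (s + u) ^ CARD('d)) - ennreal (?V * (s - u) ^ CARD('d))"
    using assms by (simp add: emeasure_ball emeasure_cball)
  also have "\<dots> = ennreal (?V * ((s + u) ^ CARD('d) - (s - u) ^ CARD('d)))"
    using assms by (subst ennreal_minus) (auto simp: right_diff_distrib)
  also have "\<dots> \<le> ennreal (?V * (real CARD('d) * (s + u) ^ (CARD('d) - 1) * (2 * u)))"
    using power_diff_le[of "s - u" "s + u" "CARD('d)"] assms
    by (intro ennreal_leI mult_left_mono) auto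
  finally show ?thesis .
qed

text \<open>The steps \<open>v\<close> range over a whole ball and the error \<open>E\<close> depends only on its radius; this makes
  the property invariant under rotations and hence under rotation averages.\<close>

definition difference_bounded :: "real \<Rightarrow> nat \<Rightarrow> (nat \<Rightarrow> real) \<Rightarrow> real \<Rightarrow> (real^'d \<Rightarrow> real) \<Rightarrow> bool" where
  "difference_bounded \<delta> m B E h \<longleftrightarrow>
     (\<forall>x v. norm v \<le> \<delta> \<longrightarrow> h x \<le> (\<Sum>k=1..m. B k * h (x + of_nat k *\<^sub>R v)) + E)"

context rotation_walk
begin

lemma difference_bounded_rot_avg:
  assumes h: "difference_bounded \<delta> m B E h" and a: "a \<in> levels"
  shows "difference_bounded \<delta> m B E (rot_avg a h)"
  unfolding difference_bounded_def
proof (intro allI impI)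
  fix x v :: "real^'d" assume v: "norm v \<le> \<delta>"
  let ?I = "level_set n r a" and ?c = "\<lambda>i. p i / weight a" and ?M = "\<lambda>i. matrix_inv (Q i)"
  have "rot_avg a h x \<le> (\<Sum>i\<in>?I. ?c i * ((\<Sum>k=1..m. B k * h (?M i *v (x + of_nat k *\<^sub>R v))) + E))"
    unfolding rot_avg_def
  proof (intro sum_mono mult_left_mono)
    fix i assume i: "i \<in> ?I"
    have "norm (?M i *v v) \<le> \<delta>" using v SO_norm[OF inv_SO[OF i]] by simp
    then have "h (?M i *v x) \<le> (\<Sum>k=1..m. B k * h (?M i *v x + of_nat k *\<^sub>R (?M i *v v))) + E"
      using h by (simp add: difference_bounded_def)
    then show "h (?M i *v x) \<le> (\<Sum>k=1..m. B k * h (?M i *v (x + of_nat k *\<^sub>R v))) + E"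
      by (simp add: matrix_vector_right_distrib matrix_vector_mult_scaleR)
  qed (rule coeff_nonneg)
  also have "\<dots> = (\<Sum>i\<in>?I. \<Sum>k=1..m. B k * (?c i * h (?M i *v (x + of_nat k *\<^sub>R v)))) + E * (\<Sum>i\<in>?I. ?c i)"
    by (simp add: distrib_left sum.distrib sum_distrib_left mult_ac)
  also have "\<dots> = (\<Sum>k=1..m. B k * rot_avg a h (x + of_nat k *\<^sub>R v)) + E"
    unfolding coeff_sum[OF a] by (subst sum.swap) (simp only: rot_avg_def sum_distrib_left mult_1_right)
  finally show "rot_avg a h x \<le> (\<Sum>k=1..m. B k * rot_avg a h (x + of_nat k *\<^sub>R v)) + E" .
qed

lemma difference_bounded_rot_avgs:
  assumes "difference_bounded \<delta> m B E h" "set w \<subseteq> levels"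
  shows "difference_bounded \<delta> m B E (rot_avgs w h)"
  using assms(2) by (induction w) (auto simp: rot_avgs_simps assms(1) difference_bounded_rot_avg)

lemma gap_prod_nonneg: "set w \<subseteq> levels \<Longrightarrow> 0 \<le> (\<Prod>a\<leftarrow>w. gap a)"
  by (induction w) (auto intro!: mult_nonneg_nonneg gap_nonneg)

text \<open>Integrated over an annulus, the mean-square contraction on each orbit controls the deviation of
  a rotation average from the orbit mean in \<open>L\<^sup>2\<close> of the annulus.\<close>

lemma annulus_deviation:
  assumes w: "set w \<subseteq> levels" and h [measurable]: "h \<in> borel_measurable borel"
    and h01: "\<And>x. 0 \<le> h x" "\<And>x. h x \<le> 1"
  shows "(\<integral>\<^sup>+x. indicator {x. l \<le> norm x \<and> norm x \<le> u} x * ennreal ((rot_avgs w h x - orbit_mean h x)\<^sup>2) \<partial>lborel)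
    \<le> ennreal ((\<Prod>a\<leftarrow>w. gap a)\<^sup>2) * emeasure lborel {x::real^'d. l \<le> norm x \<and> norm x \<le> u}"
proof -
  let ?A = "{x::real^'d. l \<le> norm x \<and> norm x \<le> u}"
  let ?G = "\<lambda>x. indicator ?A x * ennreal ((rot_avgs w h x - orbit_mean h x)\<^sup>2)"
  let ?N = "\<Prod>a\<leftarrow>w. gap a"
  have [measurable]: "?A \<in> sets borel" by measurable
  have [measurable]: "orbit_mean h \<in> borel_measurable borel" "rot_avgs w h \<in> borel_measurable borel"
    by (auto intro: measurable_orbit_mean measurable_rot_avgs)
  have "(\<integral>\<^sup>+x. ?G x \<partial>lborel) = (\<integral>\<^sup>+x. (\<integral>\<^sup>+g. ?G (g *v x) \<partial>\<mu>) \<partial>lborel)"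
    by (rule nn_integral_lborel_orbit_average) measurable
  also have "\<dots> \<le> (\<integral>\<^sup>+x. ennreal (?N\<^sup>2) * indicator ?A x \<partial>lborel)"
  proof (rule nn_integral_mono)
    fix x :: "real^'d"
    let ?D = "\<lambda>g. rot_avgs w h (g *v x) - orbit_mean h x"
    have dev: "(\<lambda>g. complex_of_real (?D g)) \<in> L2_zero_mean \<mu>"
      "L2_norm \<mu> (\<lambda>g. complex_of_real (?D g)) \<le> ?N"
      using rot_avgs_deviation[OF w h h01] by auto
    then have int: "integrable \<mu> (\<lambda>g. (?D g)\<^sup>2)"
      by (auto simp: L2_zero_mean_def simp del: of_real_diff)
    have le: "(LINT g|\<mu>. (?D g)\<^sup>2) \<le> ?N\<^sup>2"
      using dev(2) by (simp add: L2_norm_def real_le_rsqrt sqrt_le_D del: of_real_diff)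
    have "(\<integral>\<^sup>+g. ?G (g *v x) \<partial>\<mu>) = (\<integral>\<^sup>+g. indicator ?A x * ennreal ((?D g)\<^sup>2) \<partial>\<mu>)"
    proof (rule nn_integral_cong)
      fix g assume "g \<in> space \<mu>"
      then have g: "g \<in> SO" by (simp add: space_mu)
      show "?G (g *v x) = indicator ?A x * ennreal ((?D g)\<^sup>2)"
        using SO_norm[OF g] orbit_mean_rotate[OF h h01(1) g] by (simp add: indicator_def)
    qed
    also have "\<dots> = indicator ?A x * (\<integral>\<^sup>+g. ennreal ((?D g)\<^sup>2) \<partial>\<mu>)"
      by (rule nn_integral_cmult) simp
    also have "(\<integral>\<^sup>+g. ennreal ((?D g)\<^sup>2) \<partial>\<mu>) = ennreal (LINT g|\<mu>. (?D g)\<^sup>2)"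
      using int by (intro nn_integral_eq_integral) auto
    also have "indicator ?A x * \<dots> \<le> indicator ?A x * ennreal (?N\<^sup>2)"
      using le by (intro mult_left_mono ennreal_leI) auto
    finally show "(\<integral>\<^sup>+g. ?G (g *v x) \<partial>\<mu>) \<le> ennreal (?N\<^sup>2) * indicator ?A x"
      by (simp add: mult.commute)
  qed
  also have "\<dots> = ennreal (?N\<^sup>2) * emeasure lborel ?A"
    by (simp add: nn_integral_cmult_indicator)
  finally show ?thesis .
qed

end

context self_similar
begin

lemma phi_difference_bounded:
  assumes K: "AE x in \<nu>. norm x \<le> K" "K > 0" and \<delta>: "\<delta> \<ge> 0"
  shows "difference_bounded \<delta> m (\<lambda>k. real (m + 1) * (real (m choose k))\<^sup>2)
    (real (m + 1) * (2 * pi * K * \<delta>) ^ (2 * m)) \<phi>"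
  unfolding difference_bounded_def
proof (intro allI impI)
  fix x v :: "real^'d" assume v: "norm v \<le> \<delta>"
  let ?E = "(2 * pi * K * \<delta>) ^ m"
  let ?y = "\<lambda>k. if k = 0 then ?E else real (m choose k) * cmod (fourier_measure \<nu> (x + of_nat k *\<^sub>R v))"
  have split: "(\<Sum>k=0..m. g k) = g 0 + (\<Sum>k=1..m. g k)" for g :: "nat \<Rightarrow> real"
    by (simp add: sum.atLeast_Suc_atMost)
  have "(2 * pi * K * norm v) ^ m \<le> ?E"
    using v K by (intro power_mono mult_left_mono) auto
  then have "cmod (fourier_measure \<nu> x) \<le> ?E + (\<Sum>k=1..m. real (m choose k) * cmod (fourier_measure \<nu> (x + of_nat k *\<^sub>R v)))"
    using fourier_difference[OF K, of x m v] by linarith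
  also have "\<dots> = (\<Sum>k=0..m. ?y k)"
    unfolding split by simp
  finally have "\<phi> x \<le> (\<Sum>k=0..m. ?y k)\<^sup>2"
    unfolding \<phi>_def by (intro power_mono) auto
  also have "\<dots> \<le> real (m + 1) * (\<Sum>k=0..m. (?y k)\<^sup>2)"
    using sum_square_le[of ?y "{0..m}"] by simp
  also have "\<dots> = real (m + 1) * (?E\<^sup>2 + (\<Sum>k=1..m. (real (m choose k))\<^sup>2 * \<phi> (x + of_nat k *\<^sub>R v)))"
    unfolding split by (simp add: \<phi>_def power_mult_distrib)
  also have "?E\<^sup>2 = (2 * pi * K * \<delta>) ^ (2 * m)"
    by (simp add: power_mult[symmetric] mult.commute)
  finally show "\<phi> x \<le> (\<Sum>k=1..m. real (m + 1) * (real (m choose k))\<^sup>2 * \<phi> (x + of_nat k *\<^sub>R v))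
      + real (m + 1) * (2 * pi * K * \<delta>) ^ (2 * m)"
    by (simp only: distrib_left sum_distrib_left mult.assoc add.commute)
qed

text \<open>The difference inequality is squared and averaged over all steps \<open>v\<close> in a ball of radius \<open>\<delta>\<close>;
  the nodes \<open>\<eta> + k v\<close> stay in an annulus of width comparable to \<open>\<delta>\<close>, whose volume relative to that
  of the ball is \<open>(norm \<eta> / \<delta>) ^ (d - 1)\<close>.  This is the step that costs \<open>(d - 1) / 2\<close> powers of the
  frequency when passing from mean square to pointwise bounds.\<close>

lemma pointwise_from_orbit_means:
  fixes m :: nat
  obtains b where "b > 0"
    and "\<And>w \<eta> \<delta> M. \<lbrakk>set w \<subseteq> levels; 0 < \<delta>; 2 * real m * \<delta> \<le> norm \<eta>; 0 \<le> M;
      \<And>\<zeta>. norm \<eta> / 2 \<le> norm \<zeta> \<Longrightarrow> orbit_mean \<phi> \<zeta> \<le> M\<rbrakk>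
      \<Longrightarrow> rot_avgs w \<phi> \<eta> \<le> b * (M + \<delta> ^ (2 * m)
          + (\<Prod>a\<leftarrow>w. gap a) * sqrt ((norm \<eta> / \<delta>) ^ (CARD('d) - 1)))"
proof -
  obtain K where K: "K > 0" "AE x in \<nu>. norm x \<le> K" by (rule bounded_support)
  let ?d = "CARD('d)"
  define B where "B = (\<lambda>k. real (m + 1) * (real (m choose k))\<^sup>2)"
  define b1 where "b1 = (\<Sum>k=1..m. B k)"
  define b2 where "b2 = real (m + 1) * (2 * pi * K) ^ (2 * m)"
  define b4 where "b4 = (\<Sum>k=1..m. (B k)\<^sup>2) * real m * (real ?d * 2 ^ (?d - 1) * (2 * real m))"
  define b where "b = 1 + b1 + b2 + sqrt b4"
  have Bpos: "0 \<le> B k" for k by (simp add: B_def)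
  have pos: "0 \<le> b1" "0 \<le> b2" "0 \<le> b4"
    unfolding b1_def b2_def b4_def using Bpos K by (auto intro!: sum_nonneg mult_nonneg_nonneg)
  have main: "rot_avgs w \<phi> \<eta> \<le> b1 * M + b2 * \<delta> ^ (2 * m)
      + sqrt b4 * ((\<Prod>a\<leftarrow>w. gap a) * sqrt ((norm \<eta> / \<delta>) ^ (?d - 1)))"
    if w: "set w \<subseteq> levels" and \<delta>: "0 < \<delta>" and \<eta>: "2 * real m * \<delta> \<le> norm \<eta>" and M: "0 \<le> M"
      and mean: "\<And>\<zeta>. norm \<eta> / 2 \<le> norm \<zeta> \<Longrightarrow> orbit_mean \<phi> \<zeta> \<le> M" for w \<eta> \<delta> M
  proof -
    let ?N = "\<Prod>a\<leftarrow>w. gap a" and ?f = "rot_avgs w \<phi>"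
    let ?\<psi> = "\<lambda>x. ?f x - orbit_mean \<phi> x"
    let ?s = "norm \<eta>" and ?u = "real m * \<delta>" and ?V = "unit_ball_vol (real ?d)"
    let ?A = "{x::real^'d. ?s - ?u \<le> norm x \<and> norm x \<le> ?s + ?u}"
    let ?D = "?f \<eta> - (b1 * M + b2 * \<delta> ^ (2 * m))"
    let ?G = "\<lambda>x. indicator ?A x * ennreal ((?\<psi> x)\<^sup>2)"
    have N0: "0 \<le> ?N" by (rule gap_prod_nonneg[OF w])
    have [measurable]: "orbit_mean \<phi> \<in> borel_measurable borel" "?f \<in> borel_measurable borel"
      by (auto intro: measurable_orbit_mean measurable_rot_avgs)
    have [measurable]: "?A \<in> sets borel" by measurable
    have [measurable]: "(\<lambda>x. ennreal ((?\<psi> x)\<^sup>2)) \<in> borel_measurable borel" by measurable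
    have [measurable]: "?G \<in> borel_measurable borel" by measurable
    have u: "0 \<le> ?u" "?u \<le> ?s" "2 * ?u \<le> ?s"
    proof -
      show 0: "0 \<le> ?u" using \<delta> by simp
      show 2: "2 * ?u \<le> ?s" using \<eta> by (simp add: mult.assoc)
      show "?u \<le> ?s" using 0 2 by linarith
    qed
    have node: "\<eta> + of_nat k *\<^sub>R v \<in> ?A" if "k \<in> {1..m}" "norm v < \<delta>" for k v
    proof -
      have "norm (of_nat k *\<^sub>R v :: real^'d) \<le> real m * \<delta>"
        using that by (auto intro!: mult_mono)
      then show ?thesis
        using norm_triangle_ineq[of \<eta> "of_nat k *\<^sub>R v"] norm_diff_ineq[of \<eta> "of_nat k *\<^sub>R v"] by auto
    qed
    have diff: "difference_bounded \<delta> m B (b2 * \<delta> ^ (2 * m)) ?f"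
      using difference_bounded_rot_avgs[OF phi_difference_bounded[OF K(2,1), of \<delta> m] w] \<delta>
      by (simp add: B_def b2_def power_mult_distrib mult_ac)
    have ptw: "?D \<le> (\<Sum>k=1..m. B k * \<bar>?\<psi> (\<eta> + of_nat k *\<^sub>R v)\<bar>)" if v: "norm v < \<delta>" for v
    proof -
      have "?f \<eta> \<le> (\<Sum>k=1..m. B k * ?f (\<eta> + of_nat k *\<^sub>R v)) + b2 * \<delta> ^ (2 * m)"
        using diff v by (simp add: difference_bounded_def)
      also have "(\<Sum>k=1..m. B k * ?f (\<eta> + of_nat k *\<^sub>R v)) \<le> (\<Sum>k=1..m. B k * (M + \<bar>?\<psi> (\<eta> + of_nat k *\<^sub>R v)\<bar>))"
      proof (intro sum_mono mult_left_mono Bpos)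
        fix k assume k: "k \<in> {1..m}"
        have "norm \<eta> / 2 \<le> norm (\<eta> + of_nat k *\<^sub>R v)" using node[OF k v] u by auto
        then show "?f (\<eta> + of_nat k *\<^sub>R v) \<le> M + \<bar>?\<psi> (\<eta> + of_nat k *\<^sub>R v)\<bar>"
          using mean by fastforce
      qed
      also have "\<dots> = b1 * M + (\<Sum>k=1..m. B k * \<bar>?\<psi> (\<eta> + of_nat k *\<^sub>R v)\<bar>)"
        by (simp add: b1_def distrib_left sum.distrib sum_distrib_right)
      finally show ?thesis by linarith
    qed
    have "?D \<le> sqrt b4 * (?N * sqrt ((?s / \<delta>) ^ (?d - 1)))"
    proof (cases "?D \<le> 0")
      case True
      have "0 \<le> sqrt b4 * (?N * sqrt ((?s / \<delta>) ^ (?d - 1)))"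
        using pos N0 \<delta> by simp
      with True show ?thesis by linarith
    next
      case False
      let ?b = "\<Sum>k=1..m. (B k)\<^sup>2"
      have sq: "?D\<^sup>2 \<le> ?b * (\<Sum>k=1..m. (?\<psi> (\<eta> + of_nat k *\<^sub>R v))\<^sup>2)" if v: "norm v < \<delta>" for v
      proof -
        have "?D\<^sup>2 \<le> (\<Sum>k=1..m. B k * \<bar>?\<psi> (\<eta> + of_nat k *\<^sub>R v)\<bar>)\<^sup>2"
          using ptw[OF v] False by (intro power_mono) auto
        also have "\<dots> \<le> ?b * (\<Sum>k=1..m. \<bar>?\<psi> (\<eta> + of_nat k *\<^sub>R v)\<bar>\<^sup>2)"
          by (rule Cauchy_Schwarz_ineq_sum)
        finally show ?thesis by simp
      qed
      have b0: "0 \<le> ?b" by (intro sum_nonneg) auto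
      have "ennreal (?D\<^sup>2 * (?V * \<delta> ^ ?d)) = (\<integral>\<^sup>+v. ennreal (?D\<^sup>2) * indicator (ball (0::real^'d) \<delta>) v \<partial>lborel)"
        using \<delta> by (subst nn_integral_cmult_indicator) (auto simp: emeasure_ball ennreal_mult')
      also have "\<dots> \<le> (\<integral>\<^sup>+v. ennreal ?b * (\<Sum>k=1..m. ?G (\<eta> + of_nat k *\<^sub>R v)) \<partial>lborel)"
      proof (rule nn_integral_mono)
        fix v :: "real^'d"
        show "ennreal (?D\<^sup>2) * indicator (ball 0 \<delta>) v \<le> ennreal ?b * (\<Sum>k=1..m. ?G (\<eta> + of_nat k *\<^sub>R v))"
        proof (cases "norm v < \<delta>")
          case True
          have "(\<Sum>k=1..m. ?G (\<eta> + of_nat k *\<^sub>R v)) = (\<Sum>k=1..m. ennreal ((?\<psi> (\<eta> + of_nat k *\<^sub>R v))\<^sup>2))"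
            using node[OF _ True] by (intro sum.cong refl) (simp only: indicator_simps mult_1)
          also have "\<dots> = ennreal (\<Sum>k=1..m. (?\<psi> (\<eta> + of_nat k *\<^sub>R v))\<^sup>2)"
            by (intro sum_ennreal) auto
          finally show ?thesis
            using sq[OF True] b0 True by (simp add: ennreal_mult'[symmetric] ennreal_leI)
        qed simp
      qed
      also have "\<dots> = ennreal ?b * (\<Sum>k=1..m. \<integral>\<^sup>+v. ?G (\<eta> + of_nat k *\<^sub>R v) \<partial>lborel)"
      proof -
        have G: "(\<lambda>v. ?G (\<eta> + of_nat k *\<^sub>R v)) \<in> borel_measurable lborel" for k
        proof -
          have "(\<lambda>v. \<eta> + of_nat k *\<^sub>R v) \<in> lborel \<rightarrow>\<^sub>M (borel :: (real^'d) measure)" by measurable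
          from measurable_compose[OF this \<open>?G \<in> borel_measurable borel\<close>] show ?thesis .
        qed
        show ?thesis
          by (subst nn_integral_cmult, rule borel_measurable_sum, rule G)
             (subst nn_integral_sum, rule G, rule refl)
      qed
      also have "\<dots> \<le> ennreal ?b * (\<Sum>k=1..m. \<integral>\<^sup>+x. ?G x \<partial>lborel)"
        by (intro mult_left_mono sum_mono nn_integral_lborel_dilate_le) auto
      also have "\<dots> \<le> ennreal ?b * (\<Sum>k=1..m. ennreal (?N\<^sup>2) * emeasure lborel ?A)"
        by (intro mult_left_mono sum_mono annulus_deviation w) (auto intro: phi_nonneg phi_le_1)
      also have "\<dots> \<le> ennreal ?b * (\<Sum>k=1..m. ennreal (?N\<^sup>2)
          * ennreal (?V * (real ?d * (?s + ?u) ^ (?d - 1) * (2 * ?u))))"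
        by (intro mult_left_mono sum_mono emeasure_annulus_le u) auto
      also have "\<dots> = ennreal (?b * (real m * (?N\<^sup>2 * (?V * (real ?d * (?s + ?u) ^ (?d - 1) * (2 * ?u))))))"
        using b0 u(1) by (simp add: ennreal_mult' ennreal_of_nat_eq_real_of_nat)
      finally have "?D\<^sup>2 * (?V * \<delta> ^ ?d) \<le> ?b * (real m * (?N\<^sup>2 * (?V * (real ?d * (?s + ?u) ^ (?d - 1) * (2 * ?u)))))"
        using b0 u(1) by (subst (asm) ennreal_le_iff) auto
      also have "\<dots> \<le> ?b * (real m * (?N\<^sup>2 * (?V * (real ?d * (2 * ?s) ^ (?d - 1) * (2 * ?u)))))"
        using b0 u by (intro mult_left_mono mult_right_mono power_mono) auto
      also have "\<dots> = b4 * ?N\<^sup>2 * ?s ^ (?d - 1) * \<delta> * ?V"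
        by (simp add: b4_def power_mult_distrib)
      finally have "?V * (?D\<^sup>2 * \<delta> ^ ?d) \<le> ?V * (b4 * ?N\<^sup>2 * ?s ^ (?d - 1) * \<delta>)"
        by (simp only: mult_ac)
      then have "?D\<^sup>2 * \<delta> ^ ?d \<le> b4 * ?N\<^sup>2 * ?s ^ (?d - 1) * \<delta>"
        using unit_ball_vol_pos[of "real ?d"] by (subst (asm) mult_le_cancel_left_pos) auto
      moreover have "\<delta> ^ ?d = \<delta> ^ (?d - 1) * \<delta>"
        by (simp add: power_eq_if)
      ultimately have "?D\<^sup>2 * \<delta> ^ (?d - 1) * \<delta> \<le> b4 * ?N\<^sup>2 * ?s ^ (?d - 1) * \<delta>"
        by (simp add: mult_ac)
      then have "?D\<^sup>2 * \<delta> ^ (?d - 1) \<le> b4 * ?N\<^sup>2 * ?s ^ (?d - 1)"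
        using \<delta> by simp
      then have "?D\<^sup>2 \<le> b4 * ?N\<^sup>2 * (?s / \<delta>) ^ (?d - 1)"
        using \<delta> by (simp add: power_divide field_simps)
      then have "?D \<le> sqrt (b4 * ?N\<^sup>2 * (?s / \<delta>) ^ (?d - 1))"
        by (rule real_le_rsqrt)
      also have "\<dots> = sqrt b4 * (?N * sqrt ((?s / \<delta>) ^ (?d - 1)))"
        using N0 by (simp add: real_sqrt_mult)
      finally show ?thesis .
    qed
    then show ?thesis by linarith
  qed
  show ?thesis
  proof (rule that[of b])
    show "b > 0" using pos by (simp add: b_def add_pos_nonneg)
    fix w and \<eta> :: "real^'d" and \<delta> M :: real
    assume as: "set w \<subseteq> levels" "0 < \<delta>" "2 * real m * \<delta> \<le> norm \<eta>" "0 \<le> M"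
      "\<And>\<zeta>. norm \<eta> / 2 \<le> norm \<zeta> \<Longrightarrow> orbit_mean \<phi> \<zeta> \<le> M"
    let ?X = "(\<Prod>a\<leftarrow>w. gap a) * sqrt ((norm \<eta> / \<delta>) ^ (?d - 1))"
    have X: "0 \<le> ?X" using gap_prod_nonneg[OF as(1)] as(2) by simp
    have "b1 \<le> b" "b2 \<le> b" "sqrt b4 \<le> b" using pos by (auto simp: b_def)
    then have "b1 * M + b2 * \<delta> ^ (2 * m) + sqrt b4 * ?X \<le> b * M + b * \<delta> ^ (2 * m) + b * ?X"
      using as(2,4) X by (intro add_mono mult_right_mono) auto
    then show "rot_avgs w \<phi> \<eta> \<le> b * (M + \<delta> ^ (2 * m) + ?X)"
      using main[OF as] by (simp add: distrib_left)
  qed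
qed

end

section \<open>Descent through the scales\<close>

context rotation_walk
begin

lemma rot_avgs_subaverage:
  assumes h: "\<And>x. h x \<le> (\<Sum>a\<in>levels. weight a * rot_avg a h (a *\<^sub>R x))" and w: "set w \<subseteq> levels"
  shows "rot_avgs w h x \<le> (\<Sum>a\<in>levels. weight a * rot_avgs (w @ [a]) h (a *\<^sub>R x))"
  using w
proof (induction w arbitrary: x)
  case Nil
  then show ?case using h[of x] by (simp add: rot_avgs_simps)
next
  case (Cons b w)
  let ?I = "level_set n r b" and ?c = "\<lambda>i. p i / weight b" and ?M = "\<lambda>i. matrix_inv (Q i)"
  have "rot_avgs (b # w) h x
      \<le> (\<Sum>i\<in>?I. ?c i * (\<Sum>a\<in>levels. weight a * rot_avgs (w @ [a]) h (a *\<^sub>R (?M i *v x))))"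
    unfolding rot_avgs_simps(2) rot_avg_def
    using Cons by (intro sum_mono mult_left_mono coeff_nonneg) auto
  also have "\<dots> = (\<Sum>i\<in>?I. \<Sum>a\<in>levels. weight a * (?c i * rot_avgs (w @ [a]) h (?M i *v (a *\<^sub>R x))))"
    by (simp add: sum_distrib_left matrix_vector_mult_scaleR mult_ac)
  also have "\<dots> = (\<Sum>a\<in>levels. weight a * rot_avg b (rot_avgs (w @ [a]) h) (a *\<^sub>R x))"
    by (subst sum.swap) (simp only: rot_avg_def sum_distrib_left)
  finally show ?case by (simp only: append_Cons rot_avgs_simps(2))
qed

end

context self_similar
begin

abbreviation total_gap :: real where
  "total_gap \<equiv> \<Sum>a\<in>levels. weight a * gap a"

lemma total_gap_nonneg: "0 \<le> total_gap"
  by (intro sum_nonneg mult_nonneg_nonneg weight_nonneg gap_nonneg)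

lemma descent_step:
  assumes w: "set w \<subseteq> levels"
    and le: "\<And>a. a \<in> levels \<Longrightarrow> rot_avgs (w @ [a]) \<phi> (a *\<^sub>R \<eta>) \<le> A + B * (\<Prod>b\<leftarrow>w @ [a]. gap b)"
  shows "rot_avgs w \<phi> \<eta> \<le> A + B * (\<Prod>b\<leftarrow>w. gap b) * total_gap"
proof -
  let ?N = "\<Prod>b\<leftarrow>w. gap b"
  have "rot_avgs w \<phi> \<eta> \<le> (\<Sum>a\<in>levels. weight a * rot_avgs (w @ [a]) \<phi> (a *\<^sub>R \<eta>))"
    by (rule rot_avgs_subaverage[OF phi_subaverage w])
  also have "\<dots> \<le> (\<Sum>a\<in>levels. weight a * (A + B * (\<Prod>b\<leftarrow>w @ [a]. gap b)))"
    by (intro sum_mono mult_left_mono le weight_nonneg)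
  also have "\<dots> = A * (\<Sum>a\<in>levels. weight a) + B * ?N * total_gap"
    by (simp add: distrib_left sum.distrib sum_distrib_left mult_ac)
  finally show ?thesis by (simp only: sum_weight mult_1_right)
qed

text \<open>A frequency far above the scale \<open>T\<close> is brought down to it one contraction at a time.  The number
  of steps varies between words, but as \<open>total_gap \<le> 1\<close>, no step worsens the bound; the lower bound
  \<open>\<rho>\<close> on the ratios prevents a step from jumping over the window where the bound is known.\<close>

lemma descent_to_scale:
  assumes q: "total_gap \<le> 1" and \<rho>: "\<rho> > 0" "\<And>a. a \<in> levels \<Longrightarrow> \<rho> \<le> a" and T: "T > 0" and AB: "0 \<le> B"
    and base: "\<And>w \<eta>. \<lbrakk>set w \<subseteq> levels; T \<le> norm \<eta>; norm \<eta> \<le> T / \<rho>\<rbrakk>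
      \<Longrightarrow> rot_avgs w \<phi> \<eta> \<le> A + B * (\<Prod>b\<leftarrow>w. gap b)"
    and w: "set w \<subseteq> levels" and \<eta>: "T \<le> norm \<eta>"
  shows "rot_avgs w \<phi> \<eta> \<le> A + B * (\<Prod>b\<leftarrow>w. gap b)"
proof -
  let ?\<rho>' = "Max levels"
  have "?\<rho>' \<in> levels" using index_nonempty by (intro Max_in) auto
  then have \<rho>': "0 < ?\<rho>'" "?\<rho>' < 1" using r_bound by auto
  have bound: "rot_avgs w \<phi> \<eta> \<le> A + B * (\<Prod>b\<leftarrow>w. gap b)"
    if "set w \<subseteq> levels" "T \<le> norm \<eta>" "?\<rho>' ^ j * norm \<eta> \<le> T / \<rho>" for j w \<eta>
    using that
  proof (induction j arbitrary: w \<eta>)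
    case 0
    then show ?case by (intro base) auto
  next
    case (Suc j)
    show ?case
    proof (cases "norm \<eta> \<le> T / \<rho>")
      case True
      then show ?thesis using Suc.prems by (intro base) auto
    next
      case False
      have "rot_avgs w \<phi> \<eta> \<le> A + B * (\<Prod>b\<leftarrow>w. gap b) * total_gap"
      proof (rule descent_step[OF Suc.prems(1)])
        fix a assume a: "a \<in> levels"
        have a\<rho>: "\<rho> \<le> a" "a \<le> ?\<rho>'" using \<rho>(2)[OF a] a by auto
        have "T \<le> \<rho> * norm \<eta>" using False \<rho> by (simp add: field_simps)
        also have "\<dots> \<le> a * norm \<eta>" using a\<rho> by (intro mult_right_mono) auto
        finally have 1: "T \<le> norm (a *\<^sub>R \<eta>)" using a\<rho> \<rho> by simp
        have "?\<rho>' ^ j * norm (a *\<^sub>R \<eta>) \<le> ?\<rho>' ^ j * (?\<rho>' * norm \<eta>)"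
          using a\<rho> \<rho> \<rho>' by (intro mult_left_mono) (auto intro!: mult_right_mono)
        also have "\<dots> \<le> T / \<rho>" using Suc.prems(3) by (simp add: mult_ac)
        finally have 2: "?\<rho>' ^ j * norm (a *\<^sub>R \<eta>) \<le> T / \<rho>" .
        show "rot_avgs (w @ [a]) \<phi> (a *\<^sub>R \<eta>) \<le> A + B * (\<Prod>b\<leftarrow>w @ [a]. gap b)"
          by (rule Suc.IH[OF _ 1 2]) (use Suc.prems(1) a in simp)
      qed
      also have "\<dots> \<le> A + B * (\<Prod>b\<leftarrow>w. gap b)"
        using mult_left_mono[OF q, of "B * (\<Prod>b\<leftarrow>w. gap b)"] AB gap_prod_nonneg[OF Suc.prems(1)] by simp
      finally show ?thesis .
    qed
  qed
  have "0 < T / \<rho> / (norm \<eta> + 1)"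
    using T \<rho>(1) by (intro divide_pos_pos add_nonneg_pos) auto
  then obtain j where "?\<rho>' ^ j < T / \<rho> / (norm \<eta> + 1)"
    using real_arch_pow_inv[OF _ \<rho>'(2)] by blast
  then have "?\<rho>' ^ j * (norm \<eta> + 1) < T / \<rho>"
    by (subst (asm) pos_less_divide_eq) (auto intro: add_nonneg_pos)
  then have "?\<rho>' ^ j * norm \<eta> \<le> T / \<rho>"
    using zero_le_power[OF less_imp_le[OF \<rho>'(1)], of j] unfolding distrib_left mult_1_right by linarith
  then show ?thesis using bound w \<eta> by blast
qed

text \<open>The condition \<open>T \<le> \<rho> ^ k * norm \<eta>\<close> guarantees \<open>k\<close> steps before the scale \<open>T\<close> is reached,
  whatever the word, and each of these gains a factor \<open>total_gap\<close>.\<close>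

lemma descent:
  assumes q: "total_gap \<le> 1" and \<rho>: "\<rho> > 0" "\<And>a. a \<in> levels \<Longrightarrow> \<rho> \<le> a" and T: "T > 0" and AB: "0 \<le> B"
    and base: "\<And>w \<eta>. \<lbrakk>set w \<subseteq> levels; T \<le> norm \<eta>; norm \<eta> \<le> T / \<rho>\<rbrakk>
      \<Longrightarrow> rot_avgs w \<phi> \<eta> \<le> A + B * (\<Prod>b\<leftarrow>w. gap b)"
    and w: "set w \<subseteq> levels" and \<eta>: "T \<le> \<rho> ^ k * norm \<eta>"
  shows "rot_avgs w \<phi> \<eta> \<le> A + B * total_gap ^ k * (\<Prod>b\<leftarrow>w. gap b)"
  using w \<eta>
proof (induction k arbitrary: w \<eta>)
  case 0
  then show ?case using descent_to_scale[OF q \<rho> T AB base] by simp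
next
  case (Suc k)
  have "rot_avgs w \<phi> \<eta> \<le> A + B * total_gap ^ k * (\<Prod>b\<leftarrow>w. gap b) * total_gap"
  proof (rule descent_step[OF Suc.prems(1)])
    fix a assume a: "a \<in> levels"
    have "T \<le> \<rho> ^ k * (\<rho> * norm \<eta>)" using Suc.prems(2) by (simp add: mult_ac)
    also have "\<dots> \<le> \<rho> ^ k * norm (a *\<^sub>R \<eta>)"
      using \<rho>(1) \<rho>(2)[OF a] by (intro mult_left_mono) (auto intro!: mult_right_mono)
    finally have "T \<le> \<rho> ^ k * norm (a *\<^sub>R \<eta>)" .
    then show "rot_avgs (w @ [a]) \<phi> (a *\<^sub>R \<eta>) \<le> A + B * total_gap ^ k * (\<Prod>b\<leftarrow>w @ [a]. gap b)"
      by (intro Suc.IH) (use Suc.prems(1) a in auto)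
  qed
  then show ?case by (simp add: mult_ac)
qed

section \<open>Decay of the Fourier transform\<close>

text \<open>The step size is taken to be a small negative power \<open>T powr (- \<epsilon>)\<close> of the frequency, with
  \<open>(1 + \<epsilon>) (d - 1) / 2 = \<sigma>\<close>: this is where \<open>\<sigma> > (d - 1) / 2\<close> enters.  The order \<open>m\<close> of the
  difference is then large enough to make its error negligible.\<close>

lemma scale_bound:
  assumes d: "CARD('d) \<ge> 2" and \<sigma>: "\<sigma> > (real CARD('d) - 1) / 2" and \<beta>: "\<beta> > 0"
    and C: "C \<ge> 0" "\<And>\<zeta>. \<zeta> \<noteq> 0 \<Longrightarrow> orbit_mean \<phi> \<zeta> \<le> C * norm \<zeta> powr (- \<beta>)"
    and \<rho>: "0 < \<rho>" "\<rho> \<le> 1"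
  obtains A T0 where "A > 0" "T0 \<ge> 1"
    and "\<And>T w \<eta>. \<lbrakk>T0 \<le> T; set w \<subseteq> levels; T \<le> norm \<eta>; norm \<eta> \<le> T / \<rho>\<rbrakk>
      \<Longrightarrow> rot_avgs w \<phi> \<eta> \<le> A * T powr (- \<beta>) + A * T powr \<sigma> * (\<Prod>b\<leftarrow>w. gap b)"
proof -
  let ?d = "real CARD('d)"
  define \<epsilon> where "\<epsilon> = 2 * \<sigma> / (?d - 1) - 1"
  have d1: "?d - 1 > 0" using d by simp
  then have \<epsilon>: "\<epsilon> > 0" using \<sigma> by (simp add: \<epsilon>_def field_simps)
  obtain m0 :: nat where m0: "\<beta> / (2 * \<epsilon>) \<le> real m0" using real_arch_simple by blast
  define m where "m = Suc m0"
  have m: "\<beta> \<le> 2 * \<epsilon> * real m" using m0 \<epsilon> by (simp add: m_def field_simps)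
  obtain b where b: "b > 0"
    and bound: "\<And>w \<eta> \<delta> M. \<lbrakk>set w \<subseteq> levels; 0 < \<delta>; 2 * real m * \<delta> \<le> norm \<eta>; 0 \<le> M;
      \<And>\<zeta>. norm \<eta> / 2 \<le> norm \<zeta> \<Longrightarrow> orbit_mean \<phi> \<zeta> \<le> M\<rbrakk>
      \<Longrightarrow> rot_avgs w \<phi> \<eta> \<le> b * (M + \<delta> ^ (2 * m)
          + (\<Prod>a\<leftarrow>w. gap a) * sqrt ((norm \<eta> / \<delta>) ^ (CARD('d) - 1)))"
    by (rule pointwise_from_orbit_means[of m]) blast
  define A1 where "A1 = b * (C * 2 powr \<beta> + 1)"
  define A2 where "A2 = b * \<rho> powr (- ((?d - 1) / 2))"
  have A: "A1 > 0" "A2 > 0"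
    unfolding A1_def A2_def using b C \<rho> by (auto intro!: mult_pos_pos add_nonneg_pos)
  show ?thesis
  proof (rule that[of "max A1 A2" "2 * real m"])
    show "max A1 A2 > 0" using A by simp
    show "2 * real m \<ge> 1" by (simp add: m_def)
    fix T w and \<eta> :: "real^'d"
    assume T: "2 * real m \<le> T" and w: "set w \<subseteq> levels" and \<eta>: "T \<le> norm \<eta>" "norm \<eta> \<le> T / \<rho>"
    let ?N = "\<Prod>b\<leftarrow>w. gap b"
    define \<delta> where "\<delta> = T powr (- \<epsilon>)"
    have T1: "1 \<le> T" using T by (simp add: m_def)
    have \<delta>0: "0 < \<delta>" using T1 by (simp add: \<delta>_def)
    have "\<delta> \<le> 1" unfolding \<delta>_def using T1 \<epsilon> powr_mono[of "-\<epsilon>" 0 T] by simp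
    then have "2 * real m * \<delta> \<le> 2 * real m * 1" by (intro mult_left_mono) auto
    then have small: "2 * real m * \<delta> \<le> norm \<eta>" using T \<eta> by linarith
    let ?M = "C * 2 powr \<beta> * T powr (- \<beta>)"
    have mean: "orbit_mean \<phi> \<zeta> \<le> ?M" if "norm \<eta> / 2 \<le> norm \<zeta>" for \<zeta>
    proof -
      have \<zeta>: "T / 2 \<le> norm \<zeta>" using that \<eta> by linarith
      then have "\<zeta> \<noteq> 0" using T1 by auto
      then have "orbit_mean \<phi> \<zeta> \<le> C * norm \<zeta> powr (- \<beta>)" by (rule C)
      also have "\<dots> \<le> C * (T / 2) powr (- \<beta>)"
        using C \<zeta> T1 \<beta> by (intro mult_left_mono powr_mono2') auto
      also have "\<dots> = ?M" using T1 by (simp add: powr_divide powr_minus field_simps)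
      finally show ?thesis .
    qed
    have "rot_avgs w \<phi> \<eta> \<le> b * (?M + \<delta> ^ (2 * m) + ?N * sqrt ((norm \<eta> / \<delta>) ^ (CARD('d) - 1)))"
      by (rule bound[OF w \<delta>0 small _ mean]) (use C in auto)
    also have "\<dots> \<le> b * (?M + T powr (- \<beta>) + ?N * (\<rho> powr (- ((?d - 1) / 2)) * T powr \<sigma>))"
    proof (intro mult_left_mono add_mono order_refl)
      have "\<delta> ^ (2 * m) = T powr (- \<epsilon> * real (2 * m))"
        using T1 by (simp add: \<delta>_def powr_realpow[symmetric] powr_powr)
      also have "\<dots> \<le> T powr (- \<beta>)"
        using T1 m by (intro powr_mono) auto
      finally show "\<delta> ^ (2 * m) \<le> T powr (- \<beta>)" .
      have "norm \<eta> / \<delta> \<le> (T / \<rho>) / \<delta>" using \<eta> \<delta>0 by (intro divide_right_mono) auto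
      also have "\<dots> = T powr (1 + \<epsilon>) / \<rho>"
        using T1 by (simp add: \<delta>_def powr_minus powr_add divide_inverse)
      finally have "(norm \<eta> / \<delta>) ^ (CARD('d) - 1) \<le> (T powr (1 + \<epsilon>) / \<rho>) ^ (CARD('d) - 1)"
        using \<delta>0 by (intro power_mono) auto
      also have "\<dots> = (T powr (1 + \<epsilon>) / \<rho>) powr (?d - 1)"
        using T1 \<rho> d by (subst powr_realpow[symmetric]) (auto simp: of_nat_diff)
      finally have "sqrt ((norm \<eta> / \<delta>) ^ (CARD('d) - 1)) \<le> sqrt ((T powr (1 + \<epsilon>) / \<rho>) powr (?d - 1))"
        by (rule real_sqrt_le_mono)
      also have "\<dots> = (T powr (1 + \<epsilon>) / \<rho>) powr ((?d - 1) / 2)"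
        using T1 \<rho> by (simp add: powr_half_sqrt_powr)
      also have "\<dots> = T powr ((1 + \<epsilon>) * ((?d - 1) / 2)) * \<rho> powr (- ((?d - 1) / 2))"
      proof -
        have "(T powr x / \<rho>) powr e = T powr (x * e) * \<rho> powr (- e)" for x e
          using T1 \<rho> by (simp add: powr_divide powr_powr powr_minus_divide)
        then show ?thesis .
      qed
      also have "(1 + \<epsilon>) * ((?d - 1) / 2) = \<sigma>" using d1 by (simp add: \<epsilon>_def)
      finally show "sqrt ((norm \<eta> / \<delta>) ^ (CARD('d) - 1)) \<le> \<rho> powr (- ((?d - 1) / 2)) * T powr \<sigma>"
        by (simp add: mult.commute)
    qed (use b C(1) gap_prod_nonneg[OF w] in auto)
    also have "\<dots> = A1 * T powr (- \<beta>) + A2 * T powr \<sigma> * ?N"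
      by (simp add: A1_def A2_def algebra_simps)
    also have "\<dots> \<le> max A1 A2 * T powr (- \<beta>) + max A1 A2 * T powr \<sigma> * ?N"
      using gap_prod_nonneg[OF w] by (intro add_mono mult_right_mono) auto
    finally show "rot_avgs w \<phi> \<eta> \<le> max A1 A2 * T powr (- \<beta>) + max A1 A2 * T powr \<sigma> * ?N" .
  qed
qed

text \<open>The frequency \<open>R\<close> is brought down to \<open>T = R powr (1 - \<theta>)\<close>, which up to rounding takes at least
  \<open>\<theta> ln R / L\<close> steps and thus gains \<open>R powr (- \<Gamma> \<theta>)\<close>, where \<open>L\<close> is the largest \<open>- ln \<bar>r i\<bar>\<close>.  The exponent \<open>\<theta> = (\<beta> + \<sigma>) / (\<beta> + \<sigma> + \<Gamma>)\<close>
  balances \<open>T powr (- \<beta>)\<close> against \<open>R powr (- \<Gamma> \<theta>) * T powr \<sigma>\<close>.\<close>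

lemma phi_decay:
  assumes d: "CARD('d) \<ge> 2" and \<sigma>: "\<sigma> > (real CARD('d) - 1) / 2" and \<beta>: "\<beta> > 0"
    and \<Gamma>: "\<Gamma> = Gamma_rate \<mu> n r p Q" "\<Gamma> > 0"
    and C: "C \<ge> 0" "\<And>\<zeta>. \<zeta> \<noteq> 0 \<Longrightarrow> orbit_mean \<phi> \<zeta> \<le> C * norm \<zeta> powr (- \<beta>)"
  obtains D where "D > 0"
    and "\<And>\<xi>. 1 \<le> norm \<xi> \<Longrightarrow> \<phi> \<xi> \<le> D * norm \<xi> powr (- (\<beta> * \<Gamma> / (\<beta> + \<sigma> + \<Gamma>)))"
proof -
  define L where "L = Max ((\<lambda>i. - ln \<bar>r i\<bar>) ` {1..n})"
  define q where "q = total_gap"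
  define \<rho> where "\<rho> = exp (- L)"
  define S where "S = \<beta> + \<sigma> + \<Gamma>"
  define \<theta> where "\<theta> = (\<beta> + \<sigma>) / S"
  define s where "s = \<beta> * \<Gamma> / S"
  have \<sigma>0: "\<sigma> > 0" using \<sigma> d by (smt (verit) divide_nonneg_pos of_nat_1 of_nat_mono one_le_numeral order_trans)
  have S: "S > 0" using \<sigma>0 \<beta> \<Gamma> by (simp add: S_def)
  have \<theta>: "1 - \<theta> = \<Gamma> / S" "\<theta> > 0" using S \<sigma>0 \<beta> by (auto simp: \<theta>_def S_def field_simps)
  have "L \<in> (\<lambda>i. - ln \<bar>r i\<bar>) ` {1..n}" unfolding L_def using index_nonempty by (intro Max_in) auto
  then have L0: "L > 0" using r_bound by force
  have \<rho>01: "0 < \<rho>" "\<rho> \<le> 1" using L0 by (auto simp: \<rho>_def)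
  have \<rho>_le: "\<rho> \<le> a" if a: "a \<in> levels" for a
  proof -
    obtain i where i: "i \<in> {1..n}" "a = \<bar>r i\<bar>" using a by blast
    have "- ln a \<le> L" unfolding L_def using i by (intro Max_ge) auto
    then have "\<rho> \<le> exp (ln a)" by (simp add: \<rho>_def)
    then show ?thesis using r_bound[OF i(1)] i by simp
  qed
  have \<Lambda>: "- ln q = \<Gamma> * L"
  proof -
    have "\<Gamma> = - ln q / L"
      using \<Gamma>(1) by (simp only: Gamma_rate_def Lambda_def L_def q_def)
    then show ?thesis using L0 by simp
  qed
  \<comment> \<open>As \<open>ln 0 = 0\<close>, this also excludes \<open>q = 0\<close>.\<close>
  then have lnq: "ln q < 0" using \<Gamma>(2) L0 by (smt (verit) mult_pos_pos)
  have q0: "0 < q"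
    using lnq total_gap_nonneg by (cases "q = 0") (auto simp: q_def order_less_le)
  have q1: "q < 1" using lnq q0 by simp
  obtain A T0 where A: "A > 0" and T0: "T0 \<ge> 1"
    and base: "\<And>T w \<eta>. \<lbrakk>T0 \<le> T; set w \<subseteq> levels; T \<le> norm \<eta>; norm \<eta> \<le> T / \<rho>\<rbrakk>
      \<Longrightarrow> rot_avgs w \<phi> \<eta> \<le> A * T powr (- \<beta>) + A * T powr \<sigma> * (\<Prod>b\<leftarrow>w. gap b)"
    using scale_bound[OF d \<sigma> \<beta> C \<rho>01] by blast
  \<comment> \<open>\<open>1 / q\<close> pays for rounding the number of steps down, \<open>T0 powr \<beta>\<close> for the frequencies whose
    scale \<open>T\<close> is below \<open>T0\<close>, where \<open>\<phi> \<le> 1\<close> is used.\<close>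
  define D where "D = A + A / q + T0 powr \<beta>"
  have large: "\<phi> \<xi> \<le> D * norm \<xi> powr (- s)" if R: "1 \<le> norm \<xi>" and big: "T0 \<le> norm \<xi> powr (1 - \<theta>)" for \<xi>
  proof -
    let ?R = "norm \<xi>"
    define T where "T = ?R powr (1 - \<theta>)"
    define k where "k = nat \<lfloor>\<theta> * ln ?R / L\<rfloor>"
    have ne: "\<xi> \<noteq> 0" using R by auto
    have lnR: "0 \<le> ln ?R" using R by simp
    have k1: "real k \<le> \<theta> * ln ?R / L" and k2: "\<theta> * ln ?R / L - 1 \<le> real k"
      unfolding k_def using \<theta> L0 lnR by (auto simp: of_nat_nat)
    have T: "0 < T" using ne by (simp add: T_def)
    have Tk: "T \<le> \<rho> ^ k * ?R"
    proof -
      have "real k * L \<le> \<theta> * ln ?R" using k1 L0 by (simp add: field_simps)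
      then have "exp ((1 - \<theta>) * ln ?R) \<le> exp (ln ?R - real k * L)"
        by (simp add: algebra_simps)
      also have "\<dots> = \<rho> ^ k * ?R"
      proof -
        have "\<rho> ^ k = exp (real k * (- L))" by (simp only: \<rho>_def exp_of_nat_mult)
        moreover have "?R = exp (ln ?R)" using ne by simp
        ultimately have "\<rho> ^ k * ?R = exp (real k * (- L) + ln ?R)" by (metis exp_add)
        then show ?thesis by simp
      qed
      finally show ?thesis using ne by (simp add: T_def powr_def)
    qed
    have "rot_avgs [] \<phi> \<xi> \<le> A * T powr (- \<beta>) + A * T powr \<sigma> * q ^ k * (\<Prod>b\<leftarrow>[]. gap b)"
      unfolding q_def
    proof (rule descent[OF _ \<rho>01(1) \<rho>_le T])
      show "total_gap \<le> 1" using q1 by (simp add: q_def)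
      show "0 \<le> A * T powr \<sigma>" using A by simp
      show "rot_avgs w \<phi> \<eta> \<le> A * T powr (- \<beta>) + A * T powr \<sigma> * (\<Prod>b\<leftarrow>w. gap b)"
        if "set w \<subseteq> levels" "T \<le> norm \<eta>" "norm \<eta> \<le> T / \<rho>" for w \<eta>
        using base[of T w \<eta>] that big by (simp add: T_def)
    qed (use Tk in auto)
    then have "\<phi> \<xi> \<le> A * T powr (- \<beta>) + A * (T powr \<sigma> * q ^ k)"
      by (simp add: rot_avgs_simps mult_ac)
    moreover have "T powr (- \<beta>) = ?R powr (- s)"
      by (simp add: T_def powr_powr \<theta> s_def mult_ac)
    moreover have "T powr \<sigma> * q ^ k \<le> ?R powr (- s) / q"
    proof -
      have "q ^ k = exp (- (\<Gamma> * L * real k))"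
        using q0 \<Lambda> by (metis exp_of_nat_mult exp_ln minus_minus mult.commute mult_minus_left)
      also have "\<dots> \<le> exp (- (\<Gamma> * \<theta> * ln ?R) + \<Gamma> * L)"
      proof -
        have "\<theta> * ln ?R - L \<le> L * real k" using k2 L0 by (simp add: field_simps)
        then have "\<Gamma> * (\<theta> * ln ?R - L) \<le> \<Gamma> * (L * real k)" using \<Gamma> by (intro mult_left_mono) auto
        then show ?thesis by (simp add: algebra_simps)
      qed
      also have "\<dots> = ?R powr (- (\<Gamma> * \<theta>)) * (1 / q)"
      proof -
        have "exp (\<Gamma> * L) = 1 / q"
          using q0 by (simp add: \<Lambda>[symmetric] exp_minus divide_inverse)
        moreover have "exp (- (\<Gamma> * \<theta> * ln ?R)) = ?R powr (- (\<Gamma> * \<theta>))"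
          using ne by (simp add: powr_def)
        ultimately show ?thesis by (simp only: exp_add)
      qed
      finally have "T powr \<sigma> * q ^ k \<le> T powr \<sigma> * (?R powr (- (\<Gamma> * \<theta>)) * (1 / q))"
        by (intro mult_left_mono) auto
      also have "\<dots> = ?R powr ((1 - \<theta>) * \<sigma> + - (\<Gamma> * \<theta>)) / q"
        by (simp only: T_def powr_powr powr_add times_divide_eq_right mult_1_right mult.assoc)
      also have "(1 - \<theta>) * \<sigma> + - (\<Gamma> * \<theta>) = - s"
        unfolding \<theta>(1) using S by (simp add: \<theta>_def s_def field_simps)
      finally show ?thesis .
    qed
    ultimately have "\<phi> \<xi> \<le> A * ?R powr (- s) + A * (?R powr (- s) / q)"
      using A by (smt (verit) mult_left_mono)
    also have "\<dots> = (A + A / q) * ?R powr (- s)" by (simp add: algebra_simps)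
    also have "\<dots> \<le> D * ?R powr (- s)" by (intro mult_right_mono) (auto simp: D_def)
    finally show ?thesis .
  qed
  have small: "\<phi> \<xi> \<le> D * norm \<xi> powr (- s)" if R: "1 \<le> norm \<xi>" and big: "norm \<xi> powr (1 - \<theta>) \<le> T0" for \<xi>
  proof -
    let ?R = "norm \<xi>"
    have "?R powr s = (?R powr (1 - \<theta>)) powr \<beta>"
      by (simp add: powr_powr \<theta> s_def mult_ac)
    also have "\<dots> \<le> T0 powr \<beta>" using big \<beta> by (intro powr_mono2) auto
    also have "\<dots> \<le> D" using A q0 by (simp add: D_def)
    finally have le: "?R powr s \<le> D" .
    have "0 < ?R powr s" using order_less_le_trans[OF zero_less_one R] by simp
    then have "1 \<le> D * ?R powr (- s)"
      using le by (simp add: powr_minus_divide pos_le_divide_eq)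
    then show ?thesis using phi_le_1[of \<xi>] by linarith
  qed
  show ?thesis
  proof (rule that[of D])
    show "D > 0" using A q0 by (simp add: D_def add_pos_nonneg)
    show "\<phi> \<xi> \<le> D * norm \<xi> powr (- (\<beta> * \<Gamma> / (\<beta> + \<sigma> + \<Gamma>)))" if "1 \<le> norm \<xi>" for \<xi>
      using large[OF that] small[OF that] by (fold S_def s_def) linarith
  qed
qed

end

theorem claim1p11:
  fixes n :: nat
    and r p :: "nat \<Rightarrow> real"
    and Q :: "nat \<Rightarrow> real^'d^'d"
    and t :: "nat \<Rightarrow> real^'d"
    and f :: "nat \<Rightarrow> real^'d \<Rightarrow> real^'d"
    and \<nu> :: "(real^'d) measure"
    and \<mu> :: "(real^'d^'d) measure"
    and \<sigma> \<beta> \<Gamma> :: real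
  assumes "CARD('d) \<ge> 3"
    and "\<And>i. i \<in> {1..n} \<Longrightarrow> 0 < \<bar>r i\<bar> \<and> \<bar>r i\<bar> < 1"
    and "\<And>i. i \<in> {1..n} \<Longrightarrow> Q i \<in> SO"
    and "\<And>i x. i \<in> {1..n} \<Longrightarrow> f i x = r i *\<^sub>R (Q i *v x) + t i"
    and "\<And>i. i \<in> {1..n} \<Longrightarrow> p i > 0"
    and "(\<Sum>i=1..n. p i) = 1"
    and "self_similar_measure n p f \<nu>"
    and "is_haar_SO \<mu>"
    and "\<sigma> > (real CARD('d) - 1) / 2"
    and "\<Gamma> = Gamma_rate \<mu> n r p Q"
    and "\<Gamma> > 0"
    and "\<beta> > 0"
    and "\<exists>C. \<forall>R>0. (LINT \<omega>|sphere_measure. (cmod (fourier_measure \<nu> (R *\<^sub>R \<omega>)))\<^sup>2) \<le> C * R powr (- \<beta>)"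
  shows "fourier_dim \<nu> \<ge> min (real CARD('d)) (\<beta> * \<Gamma> / (\<beta> + \<sigma> + \<Gamma>))"
proof -
  interpret self_similar \<mu> n r p Q t f \<nu>
    by unfold_locales (use assms in auto)
  have d: "CARD('d) \<ge> 2" using assms(1) by simp
  obtain C where C: "\<And>R. R > 0 \<Longrightarrow>
      (LINT \<omega>|sphere_measure. (cmod (fourier_measure \<nu> (R *\<^sub>R \<omega>)))\<^sup>2) \<le> C * R powr (- \<beta>)"
    using assms(13) by blast
  have mean: "orbit_mean \<phi> \<zeta> \<le> max C 0 * norm \<zeta> powr (- \<beta>)" if "\<zeta> \<noteq> 0" for \<zeta>
  proof -
    have "orbit_mean \<phi> \<zeta> = (LINT \<omega>|sphere_measure. \<phi> (norm \<zeta> *\<^sub>R \<omega>))"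
      using that by (intro orbit_mean_sphere d measurable_phi phi_nonneg phi_le_1) auto
    also have "\<dots> \<le> C * norm \<zeta> powr (- \<beta>)"
      unfolding \<phi>_def using that by (intro C) auto
    also have "\<dots> \<le> max C 0 * norm \<zeta> powr (- \<beta>)" by (intro mult_right_mono) auto
    finally show ?thesis .
  qed
  let ?s = "\<beta> * \<Gamma> / (\<beta> + \<sigma> + \<Gamma>)" and ?m = "min (real CARD('d)) (\<beta> * \<Gamma> / (\<beta> + \<sigma> + \<Gamma>))"
  obtain D where D: "D > 0" "\<And>\<xi>. 1 \<le> norm \<xi> \<Longrightarrow> \<phi> \<xi> \<le> D * norm \<xi> powr (- ?s)"
    by (rule phi_decay[OF d assms(9,12,10,11) _ mean]) auto
  have "0 \<le> (real CARD('d) - 1) / 2" using d by simp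
  then have "\<sigma> > 0" using assms(9) by linarith
  then have s0: "0 \<le> ?m" using assms(11,12) by simp
  have bound: "cmod (fourier_measure \<nu> \<xi>) \<le> max 1 (sqrt D) * norm \<xi> powr (- ?m / 2)" if "\<xi> \<noteq> 0" for \<xi>
  proof (cases "1 \<le> norm \<xi>")
    case True
    have "cmod (fourier_measure \<nu> \<xi>) = sqrt (\<phi> \<xi>)" by (simp add: \<phi>_def)
    also have "\<dots> \<le> sqrt (D * norm \<xi> powr (- ?s))" using D(2)[OF True] by (rule real_sqrt_le_mono)
    also have "\<dots> \<le> sqrt (D * norm \<xi> powr (- ?m))"
      using D(1) True by (intro real_sqrt_le_mono mult_left_mono powr_mono) auto
    also have "\<dots> = sqrt D * norm \<xi> powr (- ?m / 2)"
      using that by (simp add: real_sqrt_mult powr_half_sqrt_powr[symmetric])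
    also have "\<dots> \<le> max 1 (sqrt D) * norm \<xi> powr (- ?m / 2)" by (intro mult_right_mono) auto
    finally show ?thesis .
  next
    case False
    have "1 = norm \<xi> powr 0" using that by simp
    also have "\<dots> \<le> norm \<xi> powr (- ?m / 2)"
      using False that s0 by (intro powr_mono') auto
    also have "\<dots> \<le> max 1 (sqrt D) * norm \<xi> powr (- ?m / 2)"
      using mult_right_mono[of 1 "max 1 (sqrt D)" "norm \<xi> powr (- ?m / 2)"] by simp
    finally show ?thesis using fourier_le_1[of \<xi>] by linarith
  qed
  show ?thesis
    unfolding fourier_dim_def
  proof (rule cSup_upper)
    show "?m \<in> {s. 0 \<le> s \<and> s \<le> real CARD('d) \<and>
        (\<exists>C. \<forall>\<xi>. \<xi> \<noteq> 0 \<longrightarrow> cmod (fourier_measure \<nu> \<xi>) \<le> C * norm \<xi> powr (- s / 2))}"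
      using s0 bound by (intro CollectI conjI) auto
  qed (auto intro!: bdd_aboveI[where M="real CARD('d)"])
qed

end
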